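(* Let $S$ be a commutative ring and let $R=S\{T_1,\dots,T_m\}/(f_1,\dots,f_r)$ be a finitely presented associative $S$-algebra. Then for any finite-cardinality $S$-module $N$ and any integer $d\geq 0$, $$0\leq |\mathrm{Coh}_{N,S}(R)| - \frac{|\mathrm{Quot}_{R^d,N,S}|}{|N|^d} \leq 2|N|\log|N|\cdot|\mathrm{Coh}_{N,S}(R)| \cdot 2^{-d}.$$ In particular, $$|\mathrm{Coh}_{N,S}(R)| = \lim_{d\to \infty} \frac{|\mathrm{Quot}_{R^d,N,S}|}{|N|^d}.$$
   Context: $S\{T_1,\dots,T_m\}$ is the free associative (noncommutative) $S$-algebra on $T_1,\dots,T_m$, and $(f_1,\dots,f_r)$ is the two-sided ideal generated by $f_1,\dots,f_r$. $\mathrm{Coh}_{N,S}(R)$ is the groupoid of left $R$-modules whose underlying $S$-module is isomorphic to $N$, with $R$-module isomorphisms as morphisms; equivalently, it is the quotient groupoid $C_{N,S}(R)/\mathrm{Aut}_S(N)$, where $C_{N,S}(R)=\{(A_1,\dots,A_m)\in \mathrm{End}_S(N)^m: f_j(A_1,\dots,A_m)=0 \text{ for } 1\leq j\leq r\}$ and $\mathrm{Aut}_S(N)$ acts by simultaneous conjugation. Its cardinality is the groupoid cardinality $|\mathrm{Coh}_{N,S}(R)|=\sum_{M}1/|\mathrm{Aut}_R(M)|$, summed over isomorphism classes of such $R$-modules $M$. $\mathrm{Quot}_{R^d,N,S}$ is the set of left $R$-submodules $E\subseteq R^d$ such that $R^d/E$ is isomorphic to $N$ as an $S$-module. $\log$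 is the natural logarithm. *)

theory Defs
  imports "HOL-Analysis.Infinite_Sum" "HOL-Algebra.QuotRing" "HOL-Algebra.Module"
begin

text \<open>
  The locale \<^locale>\<open>Module.module\<close> requires a commutative ring of scalars, so left modules over a
  possibly noncommutative ring are introduced separately, on the same record type. The fields
  \<open>mult\<close> and \<open>one\<close> of a module record are irrelevant, as they are for \<^locale>\<open>Module.module\<close>.
\<close>

locale left_module = R?: ring R + M?: abelian_group M
  for R (structure) and M :: "('a, 'b, 'c) module_scheme" (structure) +
  assumes smult_closed [simp, intro]:
      "\<lbrakk>a \<in> carrier R; x \<in> carrier M\<rbrakk> \<Longrightarrow> a \<odot>\<^bsub>M\<^esub> x \<in> carrier M"
    and smult_l_distr:
      "\<lbrakk>a \<in> carrier R; b \<in> carrier R; x \<in> carrier M\<rbrakk> \<Longrightarrow>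
        (a \<oplus>\<^bsub>R\<^esub> b) \<odot>\<^bsub>M\<^esub> x = a \<odot>\<^bsub>M\<^esub> x \<oplus>\<^bsub>M\<^esub> b \<odot>\<^bsub>M\<^esub> x"
    and smult_r_distr:
      "\<lbrakk>a \<in> carrier R; x \<in> carrier M; y \<in> carrier M\<rbrakk> \<Longrightarrow>
        a \<odot>\<^bsub>M\<^esub> (x \<oplus>\<^bsub>M\<^esub> y) = a \<odot>\<^bsub>M\<^esub> x \<oplus>\<^bsub>M\<^esub> a \<odot>\<^bsub>M\<^esub> y"
    and smult_assoc:
      "\<lbrakk>a \<in> carrier R; b \<in> carrier R; x \<in> carrier M\<rbrakk> \<Longrightarrow>
        (a \<otimes>\<^bsub>R\<^esub> b) \<odot>\<^bsub>M\<^esub> x = a \<odot>\<^bsub>M\<^esub> (b \<odot>\<^bsub>M\<^esub> x)"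
    and smult_one [simp]:
      "x \<in> carrier M \<Longrightarrow> \<one>\<^bsub>R\<^esub> \<odot>\<^bsub>M\<^esub> x = x"

text \<open>
  Isomorphisms are extensional functions on the carrier, so that distinct elements of
  \<open>mod_auts R M\<close> are distinct as maps and its cardinality is the order of the automorphism group.
\<close>

definition mod_isos ::
    "('a, 'e) ring_scheme \<Rightarrow> ('a, 'b, 'k) module_scheme \<Rightarrow> ('a, 'c, 'l) module_scheme \<Rightarrow> ('b \<Rightarrow> 'c) set"
  where "mod_isos R M N =
    {h \<in> carrier M \<rightarrow>\<^sub>E carrier N.
       (\<forall>x\<in>carrier M. \<forall>y\<in>carrier M. h (x \<oplus>\<^bsub>M\<^esub> y) = h x \<oplus>\<^bsub>N\<^esub> h y) \<and>
       (\<forall>a\<in>carrier R. \<forall>x\<in>carrier M. h (a \<odot>\<^bsub>M\<^esub> x) = a \<odot>\<^bsub>N\<^esub> h x) \<and>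
       bij_betw h (carrier M) (carrier N)}"

definition mod_isomorphic ::
    "('a, 'e) ring_scheme \<Rightarrow> ('a, 'b, 'k) module_scheme \<Rightarrow> ('a, 'c, 'l) module_scheme \<Rightarrow> bool"
  where "mod_isomorphic R M N \<longleftrightarrow> mod_isos R M N \<noteq> {}"

definition mod_auts :: "('a, 'e) ring_scheme \<Rightarrow> ('a, 'b, 'k) module_scheme \<Rightarrow> ('b \<Rightarrow> 'b) set"
  where "mod_auts R M = mod_isos R M M"

definition restrict_scalars ::
    "('s \<Rightarrow> 'a) \<Rightarrow> ('a, 'b, 'k) module_scheme \<Rightarrow> ('s, 'b) module"
  where "restrict_scalars \<phi> M =
    \<lparr>carrier = carrier M, mult = mult M, one = one M, zero = zero M, add = add M,
     smult = (\<lambda>s x. \<phi> s \<odot>\<^bsub>M\<^esub> x)\<rparr>"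

definition free_left_module :: "('a, 'e) ring_scheme \<Rightarrow> nat \<Rightarrow> ('a, nat \<Rightarrow> 'a) module"
  where "free_left_module R d =
    \<lparr>carrier = {..<d} \<rightarrow>\<^sub>E carrier R, mult = undefined, one = undefined,
     zero = (\<lambda>i\<in>{..<d}. \<zero>\<^bsub>R\<^esub>),
     add = (\<lambda>x y. \<lambda>i\<in>{..<d}. x i \<oplus>\<^bsub>R\<^esub> y i),
     smult = (\<lambda>a x. \<lambda>i\<in>{..<d}. a \<otimes>\<^bsub>R\<^esub> x i)\<rparr>"

text \<open>
  Scalar multiplication on the quotient follows the pattern of \<^const>\<open>rcoset_mult\<close>: for a
  submodule \<open>E\<close> the union is the single coset of \<open>a \<odot> x\<close>, for any representative \<open>x\<close> of \<open>C\<close>.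
\<close>

definition quotient_module ::
    "('a, 'b, 'k) module_scheme \<Rightarrow> 'b set \<Rightarrow> ('a, 'b set) module"
  where "quotient_module M E =
    \<lparr>carrier = a_rcosets\<^bsub>M\<^esub> E, mult = undefined, one = undefined,
     zero = E, add = set_add M,
     smult = (\<lambda>a C. \<Union>x\<in>C. E +>\<^bsub>M\<^esub> (a \<odot>\<^bsub>M\<^esub> x))\<rparr>"

text \<open>
  The free associative algebra \<open>S{T\<^sub>1,\<dots>,T\<^sub>m}\<close>: a word in the variables is a list over \<open>{..<m}\<close>
  (with \<open>i\<close> standing for the variable \<open>T\<^sub>i\<^sub>+\<^sub>1\<close>), and an element is the finitely supported family of
  its coefficients. Multiplication is convolution with respect to concatenation of words.
\<close>

definition free_algebra :: "('s, 'e) ring_scheme \<Rightarrow> nat \<Rightarrow> (nat list \<Rightarrow> 's) ring"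
  where "free_algebra S m =
    \<lparr>carrier = {p. (\<forall>w. p w \<in> carrier S) \<and> finite {w. p w \<noteq> \<zero>\<^bsub>S\<^esub>} \<and>
                    {w. p w \<noteq> \<zero>\<^bsub>S\<^esub>} \<subseteq> lists {..<m}},
     mult = (\<lambda>p q w. \<Oplus>\<^bsub>S\<^esub> k \<in> {..length w}. p (take k w) \<otimes>\<^bsub>S\<^esub> q (drop k w)),
     one = (\<lambda>w. if w = [] then \<one>\<^bsub>S\<^esub> else \<zero>\<^bsub>S\<^esub>),
     zero = (\<lambda>w. \<zero>\<^bsub>S\<^esub>),
     add = (\<lambda>p q w. p w \<oplus>\<^bsub>S\<^esub> q w)\<rparr>"

text \<open>
  \<open>S{T\<^sub>1,\<dots>,T\<^sub>m}/(f\<^sub>1,\<dots>,f\<^sub>r)\<close>, with the relations indexed by \<open>{..<r}\<close>. In HOL-Algebra, ideals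
  (hence \<^const>\<open>genideal\<close>) are two-sided. The \<open>S\<close>-algebra structure is given by
  \<open>fp_algebra_map\<close>, which sends \<open>s\<close> to the class of the constant \<open>s\<close>.
\<close>

definition relation_ideal ::
    "('s, 'e) ring_scheme \<Rightarrow> nat \<Rightarrow> nat \<Rightarrow> (nat \<Rightarrow> nat list \<Rightarrow> 's) \<Rightarrow> (nat list \<Rightarrow> 's) set"
  where "relation_ideal S m r f = genideal (free_algebra S m) (f ` {..<r})"

definition fp_algebra ::
    "('s, 'e) ring_scheme \<Rightarrow> nat \<Rightarrow> nat \<Rightarrow> (nat \<Rightarrow> nat list \<Rightarrow> 's) \<Rightarrow> (nat list \<Rightarrow> 's) set ring"
  where "fp_algebra S m r f = free_algebra S m Quot relation_ideal S m r f"

definition fp_algebra_map ::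
    "('s, 'e) ring_scheme \<Rightarrow> nat \<Rightarrow> nat \<Rightarrow> (nat \<Rightarrow> nat list \<Rightarrow> 's) \<Rightarrow> 's \<Rightarrow> (nat list \<Rightarrow> 's) set"
  where "fp_algebra_map S m r f s =
    relation_ideal S m r f +>\<^bsub>free_algebra S m\<^esub> (\<lambda>w. if w = [] then s else \<zero>\<^bsub>S\<^esub>)"

text \<open>
  The objects of \<open>Coh\<^bsub>N,S\<^esub>(R)\<close>, where \<open>\<phi>\<close> is the structure map \<open>S \<rightarrow> R\<close>. Carriers are taken inside
  the type of elements of \<open>N\<close>. Since the underlying set of such a module is in bijection with
  the carrier of \<open>N\<close>, every isomorphism class of \<open>R\<close>-modules with underlying \<open>S\<close>-module isomorphic
  to \<open>N\<close> is represented.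
\<close>

definition coh_objects ::
    "('s, 'e) ring_scheme \<Rightarrow> ('a, 'g) ring_scheme \<Rightarrow> ('s \<Rightarrow> 'a) \<Rightarrow> ('s, 'n, 'k) module_scheme
      \<Rightarrow> ('a, 'n) module set"
  where "coh_objects S R \<phi> N =
    {M. left_module R M \<and> mod_isomorphic S (restrict_scalars \<phi> M) N}"

definition coh_iso_rel ::
    "('s, 'e) ring_scheme \<Rightarrow> ('a, 'g) ring_scheme \<Rightarrow> ('s \<Rightarrow> 'a) \<Rightarrow> ('s, 'n, 'k) module_scheme
      \<Rightarrow> (('a, 'n) module \<times> ('a, 'n) module) set"
  where "coh_iso_rel S R \<phi> N =
    {(M, M'). M \<in> coh_objects S R \<phi> N \<and> M' \<in> coh_objects S R \<phi> N \<and> mod_isomorphic R M M'}"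

text \<open>Groupoid cardinality; the automorphism group is that of any representative of the class.\<close>

definition coh_card ::
    "('s, 'e) ring_scheme \<Rightarrow> ('a, 'g) ring_scheme \<Rightarrow> ('s \<Rightarrow> 'a) \<Rightarrow> ('s, 'n, 'k) module_scheme \<Rightarrow> real"
  where "coh_card S R \<phi> N =
    (\<Sum>\<^sub>\<infinity>X \<in> coh_objects S R \<phi> N // coh_iso_rel S R \<phi> N.
       1 / real (card (mod_auts R (SOME M. M \<in> X))))"

definition Quot_set ::
    "('s, 'e) ring_scheme \<Rightarrow> ('a, 'g) ring_scheme \<Rightarrow> ('s \<Rightarrow> 'a) \<Rightarrow> nat \<Rightarrow> ('s, 'n, 'k) module_scheme
      \<Rightarrow> (nat \<Rightarrow> 'a) set set"
  where "Quot_set S R \<phi> d N =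
    {E. submodule E R (free_left_module R d) \<and>
        mod_isomorphic S (restrict_scalars \<phi> (quotient_module (free_left_module R d) E)) N}"

end

theory Submission
  imports Defs
begin

text \<open>
  Let \<open>n = |N|\<close>. For an \<open>R\<close>-module \<open>M\<close> whose underlying \<open>S\<close>-module is isomorphic to \<open>N\<close>,
  the tuples in \<open>M\<^sup>d\<close> that generate \<open>M\<close> are the epimorphisms \<open>R\<^sup>d \<rightarrow> M\<close>, that is, the pairs of a
  submodule \<open>E \<subseteq> R\<^sup>d\<close> and an isomorphism \<open>R\<^sup>d/E \<cong> M\<close>. Hence their number is \<open>|Aut M|\<close> times the number of \<open>E\<close> with \<open>R\<^sup>d/E \<cong> M\<close>
  (\<open>card_gen_tuples\<close>). Summing over the isomorphism classes of such \<open>M\<close> gives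
    \<open>|Coh| - |Quot| / n\<^sup>d = (\<Sum>M. (1 - g\<^sub>d(M)) / |Aut M|)\<close>,
  where \<open>g\<^sub>d(M)\<close> is the probability that \<open>d\<close> random elements generate \<open>M\<close>. This is nonnegative, and it
  remains to bound \<open>1 - g\<^sub>d(M)\<close> by \<open>2 n ln n / 2\<^sup>d\<close> (\<open>card_nongen_tuples_le\<close>).

  A tuple that does not generate \<open>M\<close> lies in \<open>K\<^sup>d\<close> for some maximal submodule \<open>K\<close>, and
  \<open>|K| \<le> n/2\<close>. So \<open>1 - g\<^sub>d(M) \<le> t / 2\<^sup>d\<close>, where \<open>t\<close> is the number of maximal submodules. Two distinct
  maximal submodules have sum \<open>M\<close>, so as events in the uniform probability space \<open>M\<close> they are
  independent, and a second moment argument gives \<open>t \<le> n\<close> (\<open>card_independent_subgroups_le\<close>).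
  For \<open>n \<ge> 2\<close> this is at most \<open>2 n ln n\<close>, and for \<open>n = 1\<close> there is no maximal submodule.

  The sum over \<open>M\<close> is finite, because an \<open>S\<close>-module isomorphism with \<open>N\<close> turns the action
  of \<open>T\<^sub>1, \<dots>, T\<^sub>m\<close> into \<open>m\<close> self-maps of a finite set, and these determine \<open>M\<close> up to isomorphism
  (\<open>finite_coh_classes\<close>).
\<close>

section \<open>Free associative algebras and their quotients\<close>

text \<open>Convolution with respect to concatenation of words: the product of the free algebra, for arbitrary
  families of coefficients and words over an arbitrary alphabet.\<close>

definition concat_conv :: "('s, 'e) ring_scheme \<Rightarrow> ('x list \<Rightarrow> 's) \<Rightarrow> ('x list \<Rightarrow> 's) \<Rightarrow> 'x list \<Rightarrow> 's"
  where "concat_conv S p q w = (\<Oplus>\<^bsub>S\<^esub> k \<in> {..length w}. p (take k w) \<otimes>\<^bsub>S\<^esub> q (drop k w))"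

lemma free_algebra_simps:
  "p \<otimes>\<^bsub>free_algebra S m\<^esub> q = concat_conv S p q"
  "p \<oplus>\<^bsub>free_algebra S m\<^esub> q = (\<lambda>w. p w \<oplus>\<^bsub>S\<^esub> q w)"
  "\<one>\<^bsub>free_algebra S m\<^esub> = (\<lambda>w. if w = [] then \<one>\<^bsub>S\<^esub> else \<zero>\<^bsub>S\<^esub>)"
  "\<zero>\<^bsub>free_algebra S m\<^esub> = (\<lambda>w. \<zero>\<^bsub>S\<^esub>)"
  by (auto simp: free_algebra_def concat_conv_def fun_eq_iff)

lemma free_algebra_carrier_iff:
  "p \<in> carrier (free_algebra S m) \<longleftrightarrow>
    (\<forall>w. p w \<in> carrier S) \<and> finite {w. p w \<noteq> \<zero>\<^bsub>S\<^esub>} \<and> {w. p w \<noteq> \<zero>\<^bsub>S\<^esub>} \<subseteq> lists {..<m}"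
  by (simp add: free_algebra_def)

text \<open>The monomial with coefficient \<open>s\<close> at the word \<open>v\<close>; for \<open>v = []\<close> this is the constant \<open>s\<close>.\<close>

definition word_monom :: "('s, 'e) ring_scheme \<Rightarrow> 'x list \<Rightarrow> 's \<Rightarrow> 'x list \<Rightarrow> 's"
  where "word_monom S v s = (\<lambda>w. if w = v then s else \<zero>\<^bsub>S\<^esub>)"

text \<open>The class of the variable that the letter \<open>i\<close> stands for.\<close>

definition fp_algebra_var ::
    "('s, 'e) ring_scheme \<Rightarrow> nat \<Rightarrow> nat \<Rightarrow> (nat \<Rightarrow> nat list \<Rightarrow> 's) \<Rightarrow> nat \<Rightarrow> (nat list \<Rightarrow> 's) set"
  where "fp_algebra_var S m r f i =
    relation_ideal S m r f +>\<^bsub>free_algebra S m\<^esub> word_monom S [i] \<one>\<^bsub>S\<^esub>"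

context ring
begin

lemma concat_conv_closed:
  assumes "range p \<subseteq> carrier R" "range q \<subseteq> carrier R"
  shows "concat_conv R p q w \<in> carrier R"
proof -
  have "\<And>u. p u \<in> carrier R" "\<And>u. q u \<in> carrier R" using assms by auto
  then show ?thesis unfolding concat_conv_def by (intro finsum_closed) auto
qed

lemma concat_conv_Nil:
  assumes "range p \<subseteq> carrier R" "range q \<subseteq> carrier R"
  shows "concat_conv R p q [] = p [] \<otimes> q []"
proof -
  have "p [] \<in> carrier R" "q [] \<in> carrier R" using assms by auto
  then show ?thesis unfolding concat_conv_def by simp
qed

text \<open>Shifting the coefficients by a letter, \<open>p \<mapsto> (\<lambda>u. p (a # u))\<close>, obeys a Leibniz rule twisted by the
  constant term. This turns convolution into a recursion on words.\<close>

lemma concat_conv_Cons: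
  assumes p: "range p \<subseteq> carrier R" and q: "range q \<subseteq> carrier R"
  shows "concat_conv R p q (a # w) = p [] \<otimes> q (a # w) \<oplus> concat_conv R (\<lambda>u. p (a # u)) q w"
proof -
  let ?t = "\<lambda>k. p (take k (a # w)) \<otimes> q (drop k (a # w))"
  have cl: "\<And>u. p u \<in> carrier R" "\<And>u. q u \<in> carrier R"
    using p q by auto
  have "concat_conv R p q (a # w) = (\<Oplus>k\<in>{..Suc (length w)}. ?t k)"
    by (simp add: concat_conv_def)
  also have "\<dots> = (\<Oplus>k\<in>{..length w}. ?t (Suc k)) \<oplus> ?t 0"
    by (rule finsum_Suc2) (use cl in auto)
  also have "(\<Oplus>k\<in>{..length w}. ?t (Suc k)) = concat_conv R (\<lambda>u. p (a # u)) q w"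
    by (simp add: concat_conv_def)
  also have "\<dots> \<oplus> ?t 0 = p [] \<otimes> q (a # w) \<oplus> concat_conv R (\<lambda>u. p (a # u)) q w"
    using cl p q by (simp, intro a_comm concat_conv_closed) auto
  finally show ?thesis .
qed

lemma concat_conv_add_left:
  assumes "range p \<subseteq> carrier R" "range p' \<subseteq> carrier R" "range q \<subseteq> carrier R"
  shows "concat_conv R (\<lambda>w. p w \<oplus> p' w) q w = concat_conv R p q w \<oplus> concat_conv R p' q w"
proof -
  have cl: "\<And>u. p u \<in> carrier R" "\<And>u. p' u \<in> carrier R" "\<And>u. q u \<in> carrier R"
    using assms by auto
  have "concat_conv R (\<lambda>w. p w \<oplus> p' w) q w =
    (\<Oplus>k\<in>{..length w}. p (take k w) \<otimes> q (drop k w) \<oplus> p' (take k w) \<otimes> q (drop k w))"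
    unfolding concat_conv_def by (simp add: l_distr cl)
  also have "\<dots> = concat_conv R p q w \<oplus> concat_conv R p' q w"
    unfolding concat_conv_def by (rule finsum_addf) (auto simp: cl)
  finally show ?thesis .
qed

lemma concat_conv_add_right:
  assumes "range p \<subseteq> carrier R" "range q \<subseteq> carrier R" "range q' \<subseteq> carrier R"
  shows "concat_conv R p (\<lambda>w. q w \<oplus> q' w) w = concat_conv R p q w \<oplus> concat_conv R p q' w"
proof -
  have cl: "\<And>u. p u \<in> carrier R" "\<And>u. q' u \<in> carrier R" "\<And>u. q u \<in> carrier R"
    using assms by auto
  have "concat_conv R p (\<lambda>w. q w \<oplus> q' w) w =
    (\<Oplus>k\<in>{..length w}. p (take k w) \<otimes> q (drop k w) \<oplus> p (take k w) \<otimes> q' (drop k w))"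
    unfolding concat_conv_def by (simp add: r_distr cl)
  also have "\<dots> = concat_conv R p q w \<oplus> concat_conv R p q' w"
    unfolding concat_conv_def by (rule finsum_addf) (auto simp: cl)
  finally show ?thesis .
qed

lemma concat_conv_scale_left:
  assumes "s \<in> carrier R" "range p \<subseteq> carrier R" "range q \<subseteq> carrier R"
  shows "concat_conv R (\<lambda>w. s \<otimes> p w) q w = s \<otimes> concat_conv R p q w"
proof -
  have cl: "\<And>u. p u \<in> carrier R" "\<And>u. q u \<in> carrier R"
    using assms by auto
  show ?thesis
    unfolding concat_conv_def using assms(1) by (subst finsum_rdistr) (auto simp: cl m_assoc)
qed

lemma concat_conv_zero_left:
  assumes "range q \<subseteq> carrier R"
  shows "concat_conv R (\<lambda>w. \<zero>) q w = \<zero>"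
proof -
  have cl: "\<And>u. q u \<in> carrier R"
    using assms by auto
  show ?thesis unfolding concat_conv_def by (simp add: cl finsum_zero)
qed

lemma concat_conv_assoc:
  assumes "range p \<subseteq> carrier R" "range q \<subseteq> carrier R" "range t \<subseteq> carrier R"
  shows "concat_conv R (concat_conv R p q) t w = concat_conv R p (concat_conv R q t) w"
  using assms
proof (induction w arbitrary: p q)
  case Nil
  have cl: "p u \<in> carrier R" "q u \<in> carrier R" "t u \<in> carrier R" for u
    using Nil by auto
  have "range (concat_conv R p q) \<subseteq> carrier R" "range (concat_conv R q t) \<subseteq> carrier R"
    using Nil by (auto intro: concat_conv_closed)
  then show ?case
    using Nil by (simp add: concat_conv_Nil cl m_assoc)
next
  case (Cons a w)
  let ?p = "\<lambda>u. p (a # u)" and ?q = "\<lambda>u. q (a # u)"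
  have cl: "p u \<in> carrier R" "q u \<in> carrier R" "t u \<in> carrier R" for u
    using Cons.prems by auto
  have rp: "range ?p \<subseteq> carrier R" and rq: "range ?q \<subseteq> carrier R"
    using cl by auto
  have r: "range (concat_conv R p q) \<subseteq> carrier R" "range (concat_conv R q t) \<subseteq> carrier R"
     "range (concat_conv R ?p q) \<subseteq> carrier R" "range (concat_conv R ?q t) \<subseteq> carrier R"
     "range (\<lambda>u. p [] \<otimes> ?q u) \<subseteq> carrier R"
    using Cons.prems rp rq by (auto intro!: concat_conv_closed simp: cl)
  have c: "concat_conv R ?q t w \<in> carrier R" "concat_conv R ?p (concat_conv R q t) w \<in> carrier R"
    using rp rq r Cons.prems by (auto intro!: concat_conv_closed)
  have "concat_conv R (concat_conv R p q) t (a # w)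
      = p [] \<otimes> q [] \<otimes> t (a # w)
        \<oplus> concat_conv R (\<lambda>u. p [] \<otimes> ?q u \<oplus> concat_conv R ?p q u) t w"
    using Cons.prems r by (simp add: concat_conv_Cons concat_conv_Nil)
  also have "concat_conv R (\<lambda>u. p [] \<otimes> ?q u \<oplus> concat_conv R ?p q u) t w
      = p [] \<otimes> concat_conv R ?q t w \<oplus> concat_conv R ?p (concat_conv R q t) w"
    using r Cons rq rp
    by (subst concat_conv_add_left) (auto simp: concat_conv_scale_left cl)
  also have "p [] \<otimes> q [] \<otimes> t (a # w) \<oplus> \<dots>
      = p [] \<otimes> (q [] \<otimes> t (a # w) \<oplus> concat_conv R ?q t w) \<oplus> concat_conv R ?p (concat_conv R q t) w"
    using c by (simp add: cl m_assoc r_distr a_assoc)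
  also have "\<dots> = concat_conv R p (concat_conv R q t) (a # w)"
    using Cons.prems r by (simp add: concat_conv_Cons)
  finally show ?case .
qed

lemma range_word_monom: "s \<in> carrier R \<Longrightarrow> range (word_monom R v s) \<subseteq> carrier R"
  by (auto simp: word_monom_def)

lemma word_monom_Nil_conv:
  assumes s: "s \<in> carrier R" and q: "range q \<subseteq> carrier R"
  shows "concat_conv R (word_monom R [] s) q w = s \<otimes> q w"
proof -
  have cl: "\<And>u. q u \<in> carrier R" using q by auto
  show ?thesis
  proof (cases w)
    case Nil
    then show ?thesis
      using concat_conv_Nil[OF range_word_monom[OF s] q] by (simp add: word_monom_def)
  next
    case (Cons a u)
    have "(\<lambda>u. word_monom R [] s (a # u)) = (\<lambda>_. \<zero>)"
      by (simp add: word_monom_def)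
    then show ?thesis
      using concat_conv_Cons[OF range_word_monom[OF s] q] Cons cl s
      by (simp add: concat_conv_zero_left[OF q]) (simp add: word_monom_def)
  qed
qed

lemma word_monom_letter_conv:
  assumes s: "s \<in> carrier R"
  shows "concat_conv R (word_monom R [a] \<one>) (word_monom R v s) = word_monom R (a # v) s"
proof
  fix w
  have r: "range (word_monom R v s) \<subseteq> carrier R" using s by (rule range_word_monom)
  have shift: "(\<lambda>u. word_monom R [a] \<one> (b # u)) =
      (if b = a then word_monom R [] \<one> else (\<lambda>u. \<zero>))" for b
    by (auto simp: word_monom_def fun_eq_iff)
  show "concat_conv R (word_monom R [a] \<one>) (word_monom R v s) w = word_monom R (a # v) s w"
  proof (cases w)
    case Nil
    have "word_monom R [a] \<one> [] = \<zero>" by (simp add: word_monom_def)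
    then show ?thesis
      using concat_conv_Nil[OF range_word_monom r, of \<one> "[a]"] Nil s
      by (simp add: word_monom_def)
  next
    case (Cons b u)
    have z: "word_monom R [a] \<one> [] = \<zero>" by (simp add: word_monom_def)
    have cl: "word_monom R v s u \<in> carrier R" for u using r by auto
    have "concat_conv R (\<lambda>u. word_monom R [a] \<one> (b # u)) (word_monom R v s) u \<in> carrier R"
      by (rule concat_conv_closed[OF _ r]) (auto simp: word_monom_def)
    then have "concat_conv R (word_monom R [a] \<one>) (word_monom R v s) w =
        concat_conv R (\<lambda>u. word_monom R [a] \<one> (b # u)) (word_monom R v s) u"
      using Cons cl concat_conv_Cons[OF range_word_monom r, of \<one> "[a]" b u]
      by (simp add: z)
    then show ?thesis
      using Cons word_monom_Nil_conv[OF _ r, of \<one>] concat_conv_zero_left[OF r] cl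
      by (simp add: shift) (simp add: word_monom_def)
  qed
qed

lemma conv_one_right:
  assumes p: "range p \<subseteq> carrier R"
  shows "concat_conv R p (word_monom R [] \<one>) w = p w"
  using p
proof (induction w arbitrary: p)
  case Nil
  then show ?case
    using concat_conv_Nil[OF Nil range_word_monom, of \<one> "[]"]
    by (auto simp: word_monom_def image_subset_iff)
next
  case (Cons a w)
  have cl: "\<And>u. p u \<in> carrier R" using Cons.prems by auto
  have "concat_conv R p (word_monom R [] \<one>) (a # w) = p [] \<otimes> word_monom R [] \<one> (a # w) \<oplus> p (a # w)"
    using concat_conv_Cons[OF Cons.prems range_word_monom, of \<one> "[]" a w] Cons.IH[of "\<lambda>u. p (a # u)"] cl
    by (simp add: image_subset_iff)
  then show ?case using cl by (simp add: word_monom_def)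
qed

end

context cring
begin

lemma free_algebra_mult_closed:
  assumes p: "p \<in> carrier (free_algebra R m)" and q: "q \<in> carrier (free_algebra R m)"
  shows "concat_conv R p q \<in> carrier (free_algebra R m)"
proof -
  let ?s = "\<lambda>p. {w. p w \<noteq> \<zero>}"
  have cl: "\<And>u. p u \<in> carrier R" "\<And>u. q u \<in> carrier R"
    using p q by (auto simp: free_algebra_carrier_iff)
  have sub: "?s (concat_conv R p q) \<subseteq> (\<lambda>(u, v). u @ v) ` (?s p \<times> ?s q)"
  proof
    fix w assume w: "w \<in> ?s (concat_conv R p q)"
    have "\<exists>k\<le>length w. p (take k w) \<otimes> q (drop k w) \<noteq> \<zero>"
    proof (rule ccontr)
      assume "\<not> ?thesis"
      then have "concat_conv R p q w = (\<Oplus>k\<in>{..length w}. \<zero>)"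
        unfolding concat_conv_def by (intro finsum_cong') auto
      with w show False by (simp add: finsum_zero)
    qed
    then obtain k where "p (take k w) \<otimes> q (drop k w) \<noteq> \<zero>" by blast
    then have "take k w \<in> ?s p" "drop k w \<in> ?s q" using cl by auto
    then show "w \<in> (\<lambda>(u, v). u @ v) ` (?s p \<times> ?s q)"
      by (intro image_eqI[of _ _ "(take k w, drop k w)"]) auto
  qed
  have "finite (?s p \<times> ?s q)" using p q by (auto simp: free_algebra_carrier_iff)
  with sub have "finite (?s (concat_conv R p q))" by (meson finite_imageI finite_subset)
  moreover have "?s (concat_conv R p q) \<subseteq> lists {..<m}"
    using sub p q by (fastforce simp: free_algebra_carrier_iff)
  moreover have "\<forall>w. concat_conv R p q w \<in> carrier R"
    using cl by (auto intro: concat_conv_closed)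
  ultimately show ?thesis by (simp add: free_algebra_carrier_iff)
qed

lemma free_algebra_add_closed:
  assumes p: "p \<in> carrier (free_algebra R m)" and q: "q \<in> carrier (free_algebra R m)"
  shows "(\<lambda>w. p w \<oplus> q w) \<in> carrier (free_algebra R m)"
proof -
  have "{w. p w \<oplus> q w \<noteq> \<zero>} \<subseteq> {w. p w \<noteq> \<zero>} \<union> {w. q w \<noteq> \<zero>}" by auto
  moreover from this have "finite {w. p w \<oplus> q w \<noteq> \<zero>}"
    using p q unfolding free_algebra_carrier_iff by (meson finite_UnI finite_subset)
  ultimately show ?thesis
    using p q unfolding free_algebra_carrier_iff by blast
qed

lemma free_algebra_neg_closed:
  assumes p: "p \<in> carrier (free_algebra R m)"
  shows "(\<lambda>w. \<ominus> p w) \<in> carrier (free_algebra R m)"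
proof -
  have "{w. \<ominus> p w \<noteq> \<zero>} \<subseteq> {w. p w \<noteq> \<zero>}" by auto
  moreover from this have "finite {w. \<ominus> p w \<noteq> \<zero>}"
    using p unfolding free_algebra_carrier_iff by (meson finite_subset)
  ultimately show ?thesis
    using p unfolding free_algebra_carrier_iff by blast
qed

lemma word_monom_in_free_algebra:
  assumes "s \<in> carrier R" "v \<in> lists {..<m}"
  shows "word_monom R v s \<in> carrier (free_algebra R m)"
proof -
  have "{w. word_monom R v s w \<noteq> \<zero>} \<subseteq> {v}" by (auto simp: word_monom_def)
  with assms show ?thesis
    unfolding free_algebra_carrier_iff
    by (auto simp: word_monom_def intro: finite_subset)
qed

lemma ring_free_algebra: "ring (free_algebra R m)"
proof (rule ringI)
  show "abelian_group (free_algebra R m)"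
  proof (rule abelian_groupI)
    fix p assume p: "p \<in> carrier (free_algebra R m)"
    show "\<exists>q\<in>carrier (free_algebra R m).
        q \<oplus>\<^bsub>free_algebra R m\<^esub> p = \<zero>\<^bsub>free_algebra R m\<^esub>"
      using p by (intro bexI[OF _ free_algebra_neg_closed[OF p]])
        (auto simp: free_algebra_simps free_algebra_carrier_iff l_neg)
  qed (auto simp: free_algebra_simps free_algebra_add_closed,
       auto simp: free_algebra_carrier_iff a_ac)
  have range: "range p \<subseteq> carrier R" if "p \<in> carrier (free_algebra R m)" for p
    using that by (auto simp: free_algebra_carrier_iff)
  have one: "\<one>\<^bsub>free_algebra R m\<^esub> = word_monom R [] \<one>"
    by (simp add: free_algebra_simps word_monom_def)
  show "Group.monoid (free_algebra R m)"
  proof (rule monoidI)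
    show "\<one>\<^bsub>free_algebra R m\<^esub> \<in> carrier (free_algebra R m)"
      unfolding one by (rule word_monom_in_free_algebra) auto
    show "\<one>\<^bsub>free_algebra R m\<^esub> \<otimes>\<^bsub>free_algebra R m\<^esub> p = p"
      if "p \<in> carrier (free_algebra R m)" for p
      using range[OF that] unfolding one free_algebra_simps(1)
      by (auto simp: word_monom_Nil_conv image_subset_iff)
  qed (unfold one, auto simp: free_algebra_simps(1) free_algebra_mult_closed conv_one_right range
       intro!: concat_conv_assoc ext dest!: range)
qed (auto simp: free_algebra_simps free_algebra_carrier_iff image_subset_iff
        intro!: ext concat_conv_add_left concat_conv_add_right)

text \<open>The free algebra is generated, as a ring, by the constants and the variables.\<close>

lemma free_algebra_induct [consumes 1, case_names const var add mult]:
  assumes p: "p \<in> carrier (free_algebra R m)"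
    and const: "\<And>s. s \<in> carrier R \<Longrightarrow> P (word_monom R [] s)"
    and var: "\<And>i. i < m \<Longrightarrow> P (word_monom R [i] \<one>)"
    and add: "\<And>p q. \<lbrakk>p \<in> carrier (free_algebra R m); q \<in> carrier (free_algebra R m); P p; P q\<rbrakk>
      \<Longrightarrow> P (p \<oplus>\<^bsub>free_algebra R m\<^esub> q)"
    and mult: "\<And>p q. \<lbrakk>p \<in> carrier (free_algebra R m); q \<in> carrier (free_algebra R m); P p; P q\<rbrakk>
      \<Longrightarrow> P (p \<otimes>\<^bsub>free_algebra R m\<^esub> q)"
  shows "P p"
proof -
  have monom: "P (word_monom R v s)" if "v \<in> lists {..<m}" "s \<in> carrier R" for v s
    using that
  proof (induction v)
    case Nil
    then show ?case by (simp add: const)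
  next
    case (Cons i v)
    then have "P (word_monom R [i] \<one> \<otimes>\<^bsub>free_algebra R m\<^esub> word_monom R v s)"
      by (intro mult word_monom_in_free_algebra var) auto
    then show ?case
      using Cons by (simp add: free_algebra_simps word_monom_letter_conv)
  qed
  \<comment> \<open>split off one monomial at a time, by induction on the support\<close>
  have "finite A \<Longrightarrow> p \<in> carrier (free_algebra R m) \<Longrightarrow> {w. p w \<noteq> \<zero>} = A \<Longrightarrow> P p" for A p
  proof (induction A arbitrary: p rule: finite_induct)
    case empty
    then have "p = word_monom R [] \<zero>" by (auto simp: word_monom_def fun_eq_iff)
    then show ?case using const by simp
  next
    case (insert v A)
    let ?q = "p(v := \<zero>)"
    have v: "v \<in> lists {..<m}" and cl: "\<And>w. p w \<in> carrier R"
      using insert.prems by (auto simp: free_algebra_carrier_iff)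
    have A: "{w. ?q w \<noteq> \<zero>} = A"
      using insert by auto
    then have q: "?q \<in> carrier (free_algebra R m)"
      using insert by (auto simp: free_algebra_carrier_iff)
    have "P (word_monom R v (p v) \<oplus>\<^bsub>free_algebra R m\<^esub> ?q)"
      using insert.IH[OF q A] q v cl by (intro add monom word_monom_in_free_algebra)
    also have "word_monom R v (p v) \<oplus>\<^bsub>free_algebra R m\<^esub> ?q = p"
      using cl by (auto simp: free_algebra_simps word_monom_def fun_eq_iff)
    finally show ?case .
  qed
  then show ?thesis using p by (auto simp: free_algebra_carrier_iff)
qed

lemma
  assumes "\<And>j. j < r \<Longrightarrow> f j \<in> carrier (free_algebra R m)"
  shows ideal_relation_ideal: "ideal (relation_ideal R m r f) (free_algebra R m)"
    and ring_fp_algebra: "ring (fp_algebra R m r f)"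
proof -
  interpret F: ring "free_algebra R m" by (rule ring_free_algebra)
  show I: "ideal (relation_ideal R m r f) (free_algebra R m)"
    unfolding relation_ideal_def using assms by (intro F.genideal_ideal) auto
  then show "ring (fp_algebra R m r f)"
    unfolding fp_algebra_def by (rule ideal.quotient_is_ring)
qed

lemma fp_algebra_map_eq:
  "fp_algebra_map R m r f s = relation_ideal R m r f +>\<^bsub>free_algebra R m\<^esub> word_monom R [] s"
  by (simp add: fp_algebra_map_def word_monom_def)

context
  fixes m r :: nat and f :: "nat \<Rightarrow> nat list \<Rightarrow> 'a"
  assumes f: "\<And>j. j < r \<Longrightarrow> f j \<in> carrier (free_algebra R m)"
begin

lemma coset_ring_hom:
  "(+>\<^bsub>free_algebra R m\<^esub>) (relation_ideal R m r f) \<in> ring_hom (free_algebra R m) (fp_algebra R m r f)"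
  unfolding fp_algebra_def by (rule ideal.rcos_ring_hom[OF ideal_relation_ideal[OF f]])

lemma fp_algebra_map_closed:
  "s \<in> carrier R \<Longrightarrow> fp_algebra_map R m r f s \<in> carrier (fp_algebra R m r f)"
  unfolding fp_algebra_map_eq
  by (intro ring_hom_closed[OF coset_ring_hom] word_monom_in_free_algebra) auto

lemma fp_algebra_var_closed:
  "i < m \<Longrightarrow> fp_algebra_var R m r f i \<in> carrier (fp_algebra R m r f)"
  unfolding fp_algebra_var_def
  by (intro ring_hom_closed[OF coset_ring_hom] word_monom_in_free_algebra) auto

end

lemma fp_algebra_induct [consumes 1, case_names rel const var add mult]:
  assumes a: "a \<in> carrier (fp_algebra R m r f)"
    and rel: "\<And>j. j < r \<Longrightarrow> f j \<in> carrier (free_algebra R m)"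
    and const: "\<And>s. s \<in> carrier R \<Longrightarrow> P (fp_algebra_map R m r f s)"
    and var: "\<And>i. i < m \<Longrightarrow> P (fp_algebra_var R m r f i)"
    and add: "\<And>a b. \<lbrakk>a \<in> carrier (fp_algebra R m r f); b \<in> carrier (fp_algebra R m r f); P a; P b\<rbrakk>
      \<Longrightarrow> P (a \<oplus>\<^bsub>fp_algebra R m r f\<^esub> b)"
    and mult: "\<And>a b. \<lbrakk>a \<in> carrier (fp_algebra R m r f); b \<in> carrier (fp_algebra R m r f); P a; P b\<rbrakk>
      \<Longrightarrow> P (a \<otimes>\<^bsub>fp_algebra R m r f\<^esub> b)"
  shows "P a"
proof -
  let ?c = "\<lambda>p. relation_ideal R m r f +>\<^bsub>free_algebra R m\<^esub> p"
  have hom: "?c \<in> ring_hom (free_algebra R m) (fp_algebra R m r f)"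
    using rel by (rule coset_ring_hom)
  obtain p where p: "p \<in> carrier (free_algebra R m)" "a = ?c p"
    using a by (auto simp: fp_algebra_def FactRing_def A_RCOSETS_def')
  from p(1) have "P (?c p)"
  proof (induction p rule: free_algebra_induct)
    case (const s)
    then show ?case using assms(3) by (simp add: fp_algebra_map_eq)
  next
    case (var i)
    then show ?case using assms(4) by (simp add: fp_algebra_var_def)
  next
    case (add p q)
    then show ?case
      using assms(5) ring_hom_closed[OF hom] by (simp add: ring_hom_add[OF hom])
  next
    case (mult p q)
    then show ?case
      using assms(6) ring_hom_closed[OF hom] by (simp add: ring_hom_mult[OF hom])
  qed
  with p show ?thesis by simp
qed

end

section \<open>Homomorphisms, quotients and isomorphisms of left modules\<close>

text \<open>Homomorphisms of left modules. In contrast to the isomorphisms in \<^const>\<open>mod_isos\<close>, they are not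
  required to be extensional, so that any term defines one.\<close>

definition mod_hom ::
    "('a, 'e) ring_scheme \<Rightarrow> ('a, 'b, 'k) module_scheme \<Rightarrow> ('a, 'c, 'l) module_scheme \<Rightarrow> ('b \<Rightarrow> 'c) \<Rightarrow> bool"
  where "mod_hom R M N h \<longleftrightarrow> h \<in> carrier M \<rightarrow> carrier N \<and>
    (\<forall>x\<in>carrier M. \<forall>y\<in>carrier M. h (x \<oplus>\<^bsub>M\<^esub> y) = h x \<oplus>\<^bsub>N\<^esub> h y) \<and>
    (\<forall>a\<in>carrier R. \<forall>x\<in>carrier M. h (a \<odot>\<^bsub>M\<^esub> x) = a \<odot>\<^bsub>N\<^esub> h x)"

lemma mod_isos_iff:
  "h \<in> mod_isos R M N \<longleftrightarrow>
    h \<in> extensional (carrier M) \<and> mod_hom R M N h \<and> bij_betw h (carrier M) (carrier N)"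
  unfolding mod_isos_def mod_hom_def PiE_def by auto

lemma mod_homD:
  assumes "mod_hom R M N h"
  shows "x \<in> carrier M \<Longrightarrow> h x \<in> carrier N"
    and "x \<in> carrier M \<Longrightarrow> y \<in> carrier M \<Longrightarrow> h (x \<oplus>\<^bsub>M\<^esub> y) = h x \<oplus>\<^bsub>N\<^esub> h y"
    and "a \<in> carrier R \<Longrightarrow> x \<in> carrier M \<Longrightarrow> h (a \<odot>\<^bsub>M\<^esub> x) = a \<odot>\<^bsub>N\<^esub> h x"
  using assms unfolding mod_hom_def by auto

text \<open>The module axioms pass to the image of a surjection that respects the operations. This covers
  quotients as well as transport of structure along a bijection.\<close>

lemma left_module_surj_image:
  assumes Q: "left_module R Q" and surj: "g ` carrier Q = carrier M"
    and add: "\<And>x y. \<lbrakk>x \<in> carrier Q; y \<in> carrier Q\<rbrakk> \<Longrightarrow> g (x \<oplus>\<^bsub>Q\<^esub> y) = g x \<oplus>\<^bsub>M\<^esub> g y"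
    and smult: "\<And>a x. \<lbrakk>a \<in> carrier R; x \<in> carrier Q\<rbrakk> \<Longrightarrow> g (a \<odot>\<^bsub>Q\<^esub> x) = a \<odot>\<^bsub>M\<^esub> g x"
    and zero: "\<zero>\<^bsub>M\<^esub> = g \<zero>\<^bsub>Q\<^esub>"
  shows "left_module R M"
proof -
  interpret Q: left_module R Q by fact
  have ex: "\<exists>x\<in>carrier Q. u = g x" if "u \<in> carrier M" for u
    using that surj by auto
  have cl: "g x \<in> carrier M" if "x \<in> carrier Q" for x
    using that surj by auto
  have "abelian_group M"
  proof (rule abelian_groupI)
    show "\<zero>\<^bsub>M\<^esub> \<in> carrier M" by (simp add: zero cl)
    fix u assume "u \<in> carrier M"
    then obtain x where x: "x \<in> carrier Q" "u = g x" using ex by blast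
    then show "\<zero>\<^bsub>M\<^esub> \<oplus>\<^bsub>M\<^esub> u = u" by (simp add: zero flip: add)
    from x have "g (\<ominus>\<^bsub>Q\<^esub> x) \<oplus>\<^bsub>M\<^esub> u = \<zero>\<^bsub>M\<^esub>" by (simp add: zero Q.l_neg flip: add)
    then show "\<exists>v\<in>carrier M. v \<oplus>\<^bsub>M\<^esub> u = \<zero>\<^bsub>M\<^esub>" using x cl by (meson Q.a_inv_closed)
    fix v assume "v \<in> carrier M"
    then obtain y where y: "y \<in> carrier Q" "v = g y" using ex by blast
    from x y show "u \<oplus>\<^bsub>M\<^esub> v \<in> carrier M" by (simp add: cl flip: add)
    from x y show "u \<oplus>\<^bsub>M\<^esub> v = v \<oplus>\<^bsub>M\<^esub> u" by (simp add: Q.M.a_comm flip: add)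
    fix w assume "w \<in> carrier M"
    then obtain z where z: "z \<in> carrier Q" "w = g z" using ex by blast
    from x y z show "u \<oplus>\<^bsub>M\<^esub> v \<oplus>\<^bsub>M\<^esub> w = u \<oplus>\<^bsub>M\<^esub> (v \<oplus>\<^bsub>M\<^esub> w)"
      by (simp add: Q.M.a_assoc flip: add)
  qed
  moreover have "left_module_axioms R M"
  proof
    fix u assume "u \<in> carrier M"
    then obtain x where x: "x \<in> carrier Q" "u = g x" using ex by blast
    then show "\<one>\<^bsub>R\<^esub> \<odot>\<^bsub>M\<^esub> u = u" by (simp flip: smult)
    fix a assume a: "a \<in> carrier R"
    with x show "a \<odot>\<^bsub>M\<^esub> u \<in> carrier M" by (simp add: cl flip: smult)
    {
      fix b assume b: "b \<in> carrier R"
      from a b x show "(a \<oplus>\<^bsub>R\<^esub> b) \<odot>\<^bsub>M\<^esub> u = a \<odot>\<^bsub>M\<^esub> u \<oplus>\<^bsub>M\<^esub> b \<odot>\<^bsub>M\<^esub> u"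
        by (simp add: Q.smult_l_distr flip: smult add)
      from a b x show "(a \<otimes>\<^bsub>R\<^esub> b) \<odot>\<^bsub>M\<^esub> u = a \<odot>\<^bsub>M\<^esub> (b \<odot>\<^bsub>M\<^esub> u)"
        by (simp add: Q.smult_assoc flip: smult)
    }
    fix v assume "v \<in> carrier M"
    then obtain y where y: "y \<in> carrier Q" "v = g y" using ex by blast
    from a x y show "a \<odot>\<^bsub>M\<^esub> (u \<oplus>\<^bsub>M\<^esub> v) = a \<odot>\<^bsub>M\<^esub> u \<oplus>\<^bsub>M\<^esub> a \<odot>\<^bsub>M\<^esub> v"
      by (simp add: Q.smult_r_distr flip: smult add)
  qed
  ultimately show ?thesis by (simp add: left_module_def Q.R.ring_axioms)
qed

context left_module
begin

lemma zero_smult [simp]: "x \<in> carrier M \<Longrightarrow> \<zero>\<^bsub>R\<^esub> \<odot>\<^bsub>M\<^esub> x = \<zero>\<^bsub>M\<^esub>"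
proof -
  assume x: "x \<in> carrier M"
  have "\<zero>\<^bsub>R\<^esub> \<odot>\<^bsub>M\<^esub> x \<oplus>\<^bsub>M\<^esub> \<zero>\<^bsub>R\<^esub> \<odot>\<^bsub>M\<^esub> x = \<zero>\<^bsub>R\<^esub> \<odot>\<^bsub>M\<^esub> x"
    using smult_l_distr[of "\<zero>\<^bsub>R\<^esub>" "\<zero>\<^bsub>R\<^esub>" x] x by simp
  then show ?thesis using x by (metis M.add.r_cancel_one R.zero_closed smult_closed)
qed

lemma smult_zero [simp]: "a \<in> carrier R \<Longrightarrow> a \<odot>\<^bsub>M\<^esub> \<zero>\<^bsub>M\<^esub> = \<zero>\<^bsub>M\<^esub>"
proof -
  assume a: "a \<in> carrier R"
  have "a \<odot>\<^bsub>M\<^esub> \<zero>\<^bsub>M\<^esub> \<oplus>\<^bsub>M\<^esub> a \<odot>\<^bsub>M\<^esub> \<zero>\<^bsub>M\<^esub> = a \<odot>\<^bsub>M\<^esub> \<zero>\<^bsub>M\<^esub>"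
    using smult_r_distr[of a "\<zero>\<^bsub>M\<^esub>" "\<zero>\<^bsub>M\<^esub>"] a by simp
  then show ?thesis using a by (metis M.add.r_cancel_one M.zero_closed smult_closed)
qed

lemma smult_minus:
  assumes a: "a \<in> carrier R" and x: "x \<in> carrier M"
  shows "a \<odot>\<^bsub>M\<^esub> (\<ominus>\<^bsub>M\<^esub> x) = \<ominus>\<^bsub>M\<^esub> (a \<odot>\<^bsub>M\<^esub> x)"
  using smult_r_distr[of a "\<ominus>\<^bsub>M\<^esub> x" x] a x by (simp add: M.l_neg M.minus_equality)

lemma minus_eq_smult:
  assumes x: "x \<in> carrier M"
  shows "\<ominus>\<^bsub>M\<^esub> x = (\<ominus>\<^bsub>R\<^esub> \<one>\<^bsub>R\<^esub>) \<odot>\<^bsub>M\<^esub> x"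
  using smult_l_distr[of "\<ominus>\<^bsub>R\<^esub> \<one>\<^bsub>R\<^esub>" "\<one>\<^bsub>R\<^esub>" x] x by (simp add: R.l_neg M.minus_equality)

lemma submoduleI':
  assumes "H \<subseteq> carrier M" "\<zero>\<^bsub>M\<^esub> \<in> H"
    and "\<And>x y. \<lbrakk>x \<in> H; y \<in> H\<rbrakk> \<Longrightarrow> x \<oplus>\<^bsub>M\<^esub> y \<in> H"
    and "\<And>a x. \<lbrakk>a \<in> carrier R; x \<in> H\<rbrakk> \<Longrightarrow> a \<odot>\<^bsub>M\<^esub> x \<in> H"
  shows "submodule H R M"
proof -
  have "\<ominus>\<^bsub>M\<^esub> x \<in> H" if "x \<in> H" for x
    using minus_eq_smult[of x] assms that by auto
  then show ?thesis
    using assms by (intro submodule.intro subgroup.intro submodule_axioms.intro)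
      (auto simp flip: a_inv_def)
qed

lemma submoduleD:
  assumes "submodule H R M"
  shows "H \<subseteq> carrier M" and "\<zero>\<^bsub>M\<^esub> \<in> H"
    and "\<And>x. x \<in> H \<Longrightarrow> \<ominus>\<^bsub>M\<^esub> x \<in> H"
    and "\<And>x y. \<lbrakk>x \<in> H; y \<in> H\<rbrakk> \<Longrightarrow> x \<oplus>\<^bsub>M\<^esub> y \<in> H"
    and "\<And>a x. \<lbrakk>a \<in> carrier R; x \<in> H\<rbrakk> \<Longrightarrow> a \<odot>\<^bsub>M\<^esub> x \<in> H"
    and "abelian_subgroup H M"
proof -
  interpret submodule H R M by fact
  show "H \<subseteq> carrier M" "\<zero>\<^bsub>M\<^esub> \<in> H" 
    "\<And>x y. \<lbrakk>x \<in> H; y \<in> H\<rbrakk> \<Longrightarrow> x \<oplus>\<^bsub>M\<^esub> y \<in> H"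
    "\<And>a x. \<lbrakk>a \<in> carrier R; x \<in> H\<rbrakk> \<Longrightarrow> a \<odot>\<^bsub>M\<^esub> x \<in> H"
    using subset one_closed m_closed by auto
  show "\<And>x. x \<in> H \<Longrightarrow> \<ominus>\<^bsub>M\<^esub> x \<in> H" using m_inv_closed by (simp add: a_inv_def)
  show "abelian_subgroup H M"
    by (intro abelian_subgroupI3 additive_subgroupI subgroup_axioms M.abelian_group_axioms)
qed

lemma mod_hom_zero:
  assumes "left_module R M'" "mod_hom R M M' h"
  shows "h \<zero>\<^bsub>M\<^esub> = \<zero>\<^bsub>M'\<^esub>"
proof -
  interpret N: left_module R M' by fact
  have "h \<zero>\<^bsub>M\<^esub> = h (\<zero>\<^bsub>R\<^esub> \<odot>\<^bsub>M\<^esub> \<zero>\<^bsub>M\<^esub>)" by simp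
  also have "\<dots> = \<zero>\<^bsub>M'\<^esub>"
    using mod_homD[OF assms(2)] by (simp del: zero_smult smult_zero)
  finally show ?thesis .
qed

lemma mod_hom_minus:
  assumes "left_module R M'" "mod_hom R M M' h" "x \<in> carrier M"
  shows "h (\<ominus>\<^bsub>M\<^esub> x) = \<ominus>\<^bsub>M'\<^esub> h x"
proof -
  interpret N: left_module R M' by fact
  show ?thesis
    using mod_homD[OF assms(2)] assms(3) by (simp add: minus_eq_smult N.minus_eq_smult)
qed

lemma quotient_module_simps:
  assumes E: "submodule E R M"
  shows "carrier (quotient_module M E) = (\<lambda>x. E +>\<^bsub>M\<^esub> x) ` carrier M"
    and "\<zero>\<^bsub>quotient_module M E\<^esub> = E"
    and "\<lbrakk>x \<in> carrier M; y \<in> carrier M\<rbrakk> \<Longrightarrow>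
      (E +>\<^bsub>M\<^esub> x) \<oplus>\<^bsub>quotient_module M E\<^esub> (E +>\<^bsub>M\<^esub> y) = E +>\<^bsub>M\<^esub> (x \<oplus>\<^bsub>M\<^esub> y)"
    and "\<lbrakk>a \<in> carrier R; x \<in> carrier M\<rbrakk> \<Longrightarrow>
      a \<odot>\<^bsub>quotient_module M E\<^esub> (E +>\<^bsub>M\<^esub> x) = E +>\<^bsub>M\<^esub> (a \<odot>\<^bsub>M\<^esub> x)"
proof -
  interpret E: abelian_subgroup E M using E by (rule submoduleD)
  show "carrier (quotient_module M E) = (\<lambda>x. E +>\<^bsub>M\<^esub> x) ` carrier M"
    by (auto simp: quotient_module_def A_RCOSETS_def')
  show "\<zero>\<^bsub>quotient_module M E\<^esub> = E" by (simp add: quotient_module_def)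
  show "(E +>\<^bsub>M\<^esub> x) \<oplus>\<^bsub>quotient_module M E\<^esub> (E +>\<^bsub>M\<^esub> y) = E +>\<^bsub>M\<^esub> (x \<oplus>\<^bsub>M\<^esub> y)"
    if "x \<in> carrier M" "y \<in> carrier M"
    using E.a_rcos_sum[OF that] by (simp add: quotient_module_def)
  assume a: "a \<in> carrier R" and x: "x \<in> carrier M"
  have "E +>\<^bsub>M\<^esub> (a \<odot>\<^bsub>M\<^esub> y) = E +>\<^bsub>M\<^esub> (a \<odot>\<^bsub>M\<^esub> x)" if y: "y \<in> E +>\<^bsub>M\<^esub> x" for y
  proof -
    have yc: "y \<in> carrier M" using y x by (rule E.a_elemrcos_carrier[rotated])
    have "y \<oplus>\<^bsub>M\<^esub> \<ominus>\<^bsub>M\<^esub> x \<in> E" using E.a_rcos_module yc x y by blast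
    then have "a \<odot>\<^bsub>M\<^esub> (y \<oplus>\<^bsub>M\<^esub> \<ominus>\<^bsub>M\<^esub> x) \<in> E" using E a by (blast intro: submoduleD)
    then have "a \<odot>\<^bsub>M\<^esub> y \<in> E +>\<^bsub>M\<^esub> (a \<odot>\<^bsub>M\<^esub> x)"
      using a x yc by (simp add: E.a_rcos_module smult_r_distr smult_minus)
    then show ?thesis
      using E.a_repr_independence' a x by (metis smult_closed)
  qed
  moreover have "E +>\<^bsub>M\<^esub> x \<noteq> {}" using E.a_rcos_self[OF x] by blast
  ultimately have "(\<Union>y\<in>E +>\<^bsub>M\<^esub> x. E +>\<^bsub>M\<^esub> (a \<odot>\<^bsub>M\<^esub> y)) = E +>\<^bsub>M\<^esub> (a \<odot>\<^bsub>M\<^esub> x)"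
    by (intro SUP_eq_const)
  then show "a \<odot>\<^bsub>quotient_module M E\<^esub> (E +>\<^bsub>M\<^esub> x) = E +>\<^bsub>M\<^esub> (a \<odot>\<^bsub>M\<^esub> x)"
    by (simp add: quotient_module_def)
qed

lemma quotient_coset_eq_iff:
  assumes E: "submodule E R M" and x: "x \<in> carrier M" and y: "y \<in> carrier M"
  shows "E +>\<^bsub>M\<^esub> x = E +>\<^bsub>M\<^esub> y \<longleftrightarrow> x \<oplus>\<^bsub>M\<^esub> \<ominus>\<^bsub>M\<^esub> y \<in> E"
proof -
  interpret E: abelian_subgroup E M using E by (rule submoduleD)
  show ?thesis
    using E.a_rcos_module[OF y x] E.a_repr_independence'[OF _ y] E.a_rcos_self[OF x] by blast
qed

lemma left_module_quotient:
  assumes E: "submodule E R M"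
  shows "left_module R (quotient_module M E)"
proof (rule left_module_surj_image)
  show "left_module R M" by (rule left_module_axioms)
  show "(\<lambda>x. E +>\<^bsub>M\<^esub> x) ` carrier M = carrier (quotient_module M E)"
    using E by (simp add: quotient_module_simps)
  interpret E: abelian_subgroup E M using E by (rule submoduleD)
  show "\<zero>\<^bsub>quotient_module M E\<^esub> = E +>\<^bsub>M\<^esub> \<zero>\<^bsub>M\<^esub>"
    using E by (simp add: quotient_module_simps E.a_subset)
qed (use E in \<open>simp_all add: quotient_module_simps\<close>)

text \<open>
  An epimorphism \<open>M \<rightarrow> M'\<close> is the same as a submodule \<open>E\<close>, its kernel, together with an isomorphism
  \<open>M/E \<cong> M'\<close>. The next two lemmas are the two directions of this correspondence.\<close>

lemma mod_iso_of_epimorphism: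
  assumes M': "left_module R M'" and g: "mod_hom R M M' g" and surj: "g ` carrier M = carrier M'"
  defines "E \<equiv> {x \<in> carrier M. g x = \<zero>\<^bsub>M'\<^esub>}"
  shows "submodule E R M"
    and "\<exists>h\<in>mod_isos R (quotient_module M E) M'. \<forall>x\<in>carrier M. h (E +>\<^bsub>M\<^esub> x) = g x"
proof -
  interpret N: left_module R M' by fact
  note gD = mod_homD[OF g] mod_hom_zero[OF M' g] mod_hom_minus[OF M' g]
  show E: "submodule E R M"
    by (rule submoduleI') (auto simp: E_def gD)
  note Q = quotient_module_simps[OF E]
  define h where "h = (\<lambda>C\<in>carrier (quotient_module M E). g (SOME x. x \<in> carrier M \<and> C = E +>\<^bsub>M\<^esub> x))"
  have g_eq: "E +>\<^bsub>M\<^esub> x = E +>\<^bsub>M\<^esub> y \<longleftrightarrow> g x = g y" if "x \<in> carrier M" "y \<in> carrier M" for x y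
  proof -
    have "E +>\<^bsub>M\<^esub> x = E +>\<^bsub>M\<^esub> y \<longleftrightarrow> g x \<oplus>\<^bsub>M'\<^esub> \<ominus>\<^bsub>M'\<^esub> g y = \<zero>\<^bsub>M'\<^esub>"
      using that by (simp add: quotient_coset_eq_iff[OF E]) (simp add: E_def gD)
    also have "\<dots> \<longleftrightarrow> g x = g y"
      using that gD(1) by (metis N.M.minus_equality N.M.minus_minus N.M.r_neg N.M.a_inv_closed)
    finally show ?thesis .
  qed
  have h: "h (E +>\<^bsub>M\<^esub> x) = g x" if x: "x \<in> carrier M" for x
  proof -
    let ?y = "SOME y. y \<in> carrier M \<and> E +>\<^bsub>M\<^esub> x = E +>\<^bsub>M\<^esub> y"
    have y: "?y \<in> carrier M \<and> E +>\<^bsub>M\<^esub> x = E +>\<^bsub>M\<^esub> ?y"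
      by (rule someI_ex) (use x in blast)
    have "g x = g ?y" by (rule iffD1[OF g_eq[OF x conjunct1[OF y]] conjunct2[OF y]])
    moreover have "E +>\<^bsub>M\<^esub> x \<in> carrier (quotient_module M E)" using x by (simp add: Q)
    ultimately show ?thesis by (simp only: h_def restrict_apply' )
  qed
  have "h \<in> mod_isos R (quotient_module M E) M'"
    unfolding mod_isos_iff
  proof (intro conjI)
    show "h \<in> extensional (carrier (quotient_module M E))" by (simp add: h_def)
    show "mod_hom R (quotient_module M E) M' h"
      unfolding mod_hom_def by (auto simp: Q h gD)
    show "bij_betw h (carrier (quotient_module M E)) (carrier M')"
      unfolding bij_betw_def using surj by (auto simp: inj_on_def Q h g_eq image_image)
  qed
  then show "\<exists>h\<in>mod_isos R (quotient_module M E) M'. \<forall>x\<in>carrier M. h (E +>\<^bsub>M\<^esub> x) = g x"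
    using h by blast
qed

lemma epimorphism_of_mod_iso:
  assumes M': "left_module R M'" and E: "submodule E R M"
    and h: "h \<in> mod_isos R (quotient_module M E) M'"
  shows "mod_hom R M M' (\<lambda>x. h (E +>\<^bsub>M\<^esub> x))"
    and "(\<lambda>x. h (E +>\<^bsub>M\<^esub> x)) ` carrier M = carrier M'"
    and "{x \<in> carrier M. h (E +>\<^bsub>M\<^esub> x) = \<zero>\<^bsub>M'\<^esub>} = E"
proof -
  interpret Q: left_module R "quotient_module M E" using E by (rule left_module_quotient)
  interpret E: abelian_subgroup E M using E by (rule submoduleD)
  note Qs = quotient_module_simps[OF E]
  have hh: "mod_hom R (quotient_module M E) M' h"
    and bij: "bij_betw h (carrier (quotient_module M E)) (carrier M')"
    using h by (auto simp: mod_isos_iff)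
  show "mod_hom R M M' (\<lambda>x. h (E +>\<^bsub>M\<^esub> x))"
    using mod_homD[OF hh] unfolding mod_hom_def by (auto simp: Qs simp flip: Qs(3,4))
  show "(\<lambda>x. h (E +>\<^bsub>M\<^esub> x)) ` carrier M = carrier M'"
    using bij by (auto simp: bij_betw_def Qs image_image)
  have h0: "h E = \<zero>\<^bsub>M'\<^esub>" using Q.mod_hom_zero[OF M' hh] by (simp add: Qs)
  have "h (E +>\<^bsub>M\<^esub> x) = \<zero>\<^bsub>M'\<^esub> \<longleftrightarrow> x \<in> E" if x: "x \<in> carrier M" for x
  proof -
    have "E = E +>\<^bsub>M\<^esub> \<zero>\<^bsub>M\<^esub>" by (simp add: E.a_subset)
    then have "h (E +>\<^bsub>M\<^esub> x) = \<zero>\<^bsub>M'\<^esub> \<longleftrightarrow> h (E +>\<^bsub>M\<^esub> x) = h (E +>\<^bsub>M\<^esub> \<zero>\<^bsub>M\<^esub>)"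
      using h0 by simp
    also have "\<dots> \<longleftrightarrow> E +>\<^bsub>M\<^esub> x = E +>\<^bsub>M\<^esub> \<zero>\<^bsub>M\<^esub>"
      using bij x by (auto simp: bij_betw_def inj_on_def Qs)
    also have "\<dots> \<longleftrightarrow> x \<in> E" using x quotient_coset_eq_iff[OF E x M.zero_closed] M.minus_equality[of "\<zero>\<^bsub>M\<^esub>" "\<zero>\<^bsub>M\<^esub>"]
      by simp
    finally show ?thesis .
  qed
  then show "{x \<in> carrier M. h (E +>\<^bsub>M\<^esub> x) = \<zero>\<^bsub>M'\<^esub>} = E" using E.a_subset by auto
qed

end

text \<open>
  The carrier is closed under addition and scalar multiplication. This is all that is needed for
  isomorphisms to form a groupoid, and unlike the module axioms it passes to \<^const>\<open>restrict_scalars\<close>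
  without requiring that the map of scalars be a ring homomorphism.
\<close>

definition ops_closed :: "('a, 'e) ring_scheme \<Rightarrow> ('a, 'b, 'k) module_scheme \<Rightarrow> bool"
  where "ops_closed R M \<longleftrightarrow> (\<forall>x\<in>carrier M. \<forall>y\<in>carrier M. x \<oplus>\<^bsub>M\<^esub> y \<in> carrier M) \<and>
    (\<forall>a\<in>carrier R. \<forall>x\<in>carrier M. a \<odot>\<^bsub>M\<^esub> x \<in> carrier M)"

lemma (in left_module) ops_closed: "ops_closed R M"
  by (simp add: ops_closed_def)

lemma mod_iso_id:
  "ops_closed R M \<Longrightarrow> (\<lambda>x\<in>carrier M. x) \<in> mod_isos R M M"
  by (auto simp: mod_isos_iff mod_hom_def ops_closed_def bij_betw_def inj_on_def)

lemma mod_iso_comp: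
  assumes h: "h \<in> mod_isos R M N" and g: "g \<in> mod_isos R N L" and M: "ops_closed R M"
  shows "(\<lambda>x\<in>carrier M. g (h x)) \<in> mod_isos R M L"
proof -
  have "bij_betw (g \<circ> h) (carrier M) (carrier L)"
    using h g by (auto simp: mod_isos_iff intro: bij_betw_trans)
  then have "bij_betw (\<lambda>x\<in>carrier M. g (h x)) (carrier M) (carrier L)"
    by (simp cong: bij_betw_cong)
  then show ?thesis
    using assms by (auto simp: mod_isos_iff mod_hom_def ops_closed_def Pi_iff)
qed

lemma mod_iso_inverse:
  assumes h: "h \<in> mod_isos R M N" and M: "ops_closed R M"
  shows "(\<lambda>y\<in>carrier N. inv_into (carrier M) h y) \<in> mod_isos R N M"
proof -
  let ?i = "inv_into (carrier M) h"
  have bij: "bij_betw h (carrier M) (carrier N)" and hh: "mod_hom R M N h"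
    using h by (auto simp: mod_isos_iff)
  note hD = mod_homD[OF hh]
  have inj: "\<And>x y. \<lbrakk>x \<in> carrier M; y \<in> carrier M; h x = h y\<rbrakk> \<Longrightarrow> x = y"
    using bij by (auto simp: bij_betw_def inj_on_def)
  have i: "?i y \<in> carrier M" "h (?i y) = y" if "y \<in> carrier N" for y
    using bij that by (auto simp: bij_betw_def intro: inv_into_into f_inv_into_f)
  have N: "y \<oplus>\<^bsub>N\<^esub> z \<in> carrier N" "a \<in> carrier R \<Longrightarrow> a \<odot>\<^bsub>N\<^esub> y \<in> carrier N"
    if "y \<in> carrier N" "z \<in> carrier N" for y z a
    using hD(2)[of "?i y" "?i z"] hD(3)[of a "?i y"] hD(1)[of "?i y \<oplus>\<^bsub>M\<^esub> ?i z"]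
      hD(1)[of "a \<odot>\<^bsub>M\<^esub> ?i y"] M i that
    by (auto simp: ops_closed_def)
  have add: "?i (y \<oplus>\<^bsub>N\<^esub> z) = ?i y \<oplus>\<^bsub>M\<^esub> ?i z" if "y \<in> carrier N" "z \<in> carrier N" for y z
    using that M i N by (intro inj) (auto simp: ops_closed_def hD)
  have smult: "?i (a \<odot>\<^bsub>N\<^esub> y) = a \<odot>\<^bsub>M\<^esub> ?i y" if "a \<in> carrier R" "y \<in> carrier N" for a y
    using that M i N by (intro inj) (auto simp: ops_closed_def hD)
  have "bij_betw (\<lambda>y\<in>carrier N. ?i y) (carrier N) (carrier M)"
    using bij_betw_inv_into[OF bij] by (simp cong: bij_betw_cong)
  then show ?thesis
    using add smult N i by (auto simp: mod_isos_iff mod_hom_def)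
qed

lemma mod_isomorphic_refl: "ops_closed R M \<Longrightarrow> mod_isomorphic R M M"
  unfolding mod_isomorphic_def using mod_iso_id by blast

lemma mod_isomorphic_sym: "mod_isomorphic R M N \<Longrightarrow> ops_closed R M \<Longrightarrow> mod_isomorphic R N M"
  unfolding mod_isomorphic_def using mod_iso_inverse by blast

lemma mod_isomorphic_trans:
  "mod_isomorphic R M N \<Longrightarrow> mod_isomorphic R N L \<Longrightarrow> ops_closed R M \<Longrightarrow> mod_isomorphic R M L"
  unfolding mod_isomorphic_def using mod_iso_comp by blast

text \<open>The isomorphisms \<open>Q \<rightarrow> M\<close> are a torsor under the automorphisms of \<open>M\<close>.\<close>

lemma card_mod_isos:
  assumes iso: "mod_isomorphic R Q M" and Q: "ops_closed R Q" and M: "ops_closed R M"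
  shows "card (mod_isos R Q M) = card (mod_auts R M)"
proof -
  obtain h where h: "h \<in> mod_isos R Q M" using iso by (auto simp: mod_isomorphic_def)
  let ?i = "\<lambda>y\<in>carrier M. inv_into (carrier Q) h y"
  have i: "?i \<in> mod_isos R M Q" using h Q by (rule mod_iso_inverse)
  have bij: "bij_betw h (carrier Q) (carrier M)" using h by (simp add: mod_isos_iff)
  have hi: "x \<in> carrier Q \<Longrightarrow> h x \<in> carrier M" "x \<in> carrier Q \<Longrightarrow> ?i (h x) = x"
    "y \<in> carrier M \<Longrightarrow> ?i y \<in> carrier Q" "y \<in> carrier M \<Longrightarrow> h (?i y) = y" for x y
    using bij by (auto simp: bij_betw_def intro: inv_into_into f_inv_into_f)
  have ext: "k \<in> extensional (carrier A)" if "k \<in> mod_isos R A B" for k and A :: "('a,'x,'y) module_scheme" and B :: "('a,'z,'w) module_scheme"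
    using that by (simp add: mod_isos_iff)
  have "bij_betw (\<lambda>k. \<lambda>x\<in>carrier M. k (?i x)) (mod_isos R Q M) (mod_isos R M M)"
  proof (rule bij_betw_byWitness[where f' = "\<lambda>k. \<lambda>x\<in>carrier Q. k (h x)"])
    show "\<forall>k\<in>mod_isos R Q M. (\<lambda>x\<in>carrier Q. (\<lambda>x\<in>carrier M. k (?i x)) (h x)) = k"
      using hi by (auto intro!: extensionalityI[OF _ ext] simp del: restrict_apply)
         (simp add: hi)
    show "\<forall>k\<in>mod_isos R M M. (\<lambda>x\<in>carrier M. (\<lambda>x\<in>carrier Q. k (h x)) (?i x)) = k"
      using hi by (auto intro!: extensionalityI[OF _ ext])
    show "(\<lambda>k. \<lambda>x\<in>carrier M. k (?i x)) ` mod_isos R Q M \<subseteq> mod_isos R M M"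
      using mod_iso_comp[OF i _ M] by blast
    show "(\<lambda>k. \<lambda>x\<in>carrier Q. k (h x)) ` mod_isos R M M \<subseteq> mod_isos R Q M"
      using mod_iso_comp[OF h _ Q] by blast
  qed
  then show ?thesis unfolding mod_auts_def by (rule bij_betw_same_card)
qed

lemma finite_mod_isos:
  assumes "finite (carrier M)" "finite (carrier N)"
  shows "finite (mod_isos R M N)"
proof (rule finite_subset)
  show "mod_isos R M N \<subseteq> carrier M \<rightarrow>\<^sub>E carrier N" by (auto simp: mod_isos_def)
  show "finite (carrier M \<rightarrow>\<^sub>E carrier N)" using assms by (intro finite_PiE)
qed

lemma card_mod_auts_pos:
  "ops_closed R M \<Longrightarrow> finite (carrier M) \<Longrightarrow> 0 < card (mod_auts R M)"
  using mod_iso_id[of R M] finite_mod_isos[of M M R] by (auto simp: mod_auts_def card_gt_0_iff)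

section \<open>Generating tuples\<close>

text \<open>The \<open>i\<close>-th standard basis vector of \<open>R\<^sup>d\<close>.\<close>

definition unit_vec :: "('a, 'e) ring_scheme \<Rightarrow> nat \<Rightarrow> nat \<Rightarrow> nat \<Rightarrow> 'a"
  where "unit_vec R d i = (\<lambda>j\<in>{..<d}. if i = j then \<one>\<^bsub>R\<^esub> else \<zero>\<^bsub>R\<^esub>)"

text \<open>The image of \<open>x \<in> R\<^sup>d\<close> under the homomorphism \<open>R\<^sup>d \<rightarrow> M\<close> that sends the standard basis to \<open>t\<close>.\<close>

definition lin_comb :: "('a, 'b, 'k) module_scheme \<Rightarrow> nat \<Rightarrow> (nat \<Rightarrow> 'a) \<Rightarrow> (nat \<Rightarrow> 'b) \<Rightarrow> 'b"
  where "lin_comb M d x t = (\<Oplus>\<^bsub>M\<^esub> i\<in>{..<d}. x i \<odot>\<^bsub>M\<^esub> t i)"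

text \<open>The \<open>d\<close>-tuples of elements of \<open>M\<close> that generate it as an \<open>R\<close>-module.\<close>

definition gen_tuples :: "('a, 'e) ring_scheme \<Rightarrow> ('a, 'b, 'k) module_scheme \<Rightarrow> nat \<Rightarrow> (nat \<Rightarrow> 'b) set"
  where "gen_tuples R M d = {t \<in> {..<d} \<rightarrow>\<^sub>E carrier M.
    (\<lambda>x. lin_comb M d x t) ` carrier (free_left_module R d) = carrier M}"

lemma free_left_module_simps:
  "carrier (free_left_module R d) = {..<d} \<rightarrow>\<^sub>E carrier R"
  "\<zero>\<^bsub>free_left_module R d\<^esub> = (\<lambda>i\<in>{..<d}. \<zero>\<^bsub>R\<^esub>)"
  "x \<oplus>\<^bsub>free_left_module R d\<^esub> y = (\<lambda>i\<in>{..<d}. x i \<oplus>\<^bsub>R\<^esub> y i)"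
  "a \<odot>\<^bsub>free_left_module R d\<^esub> x = (\<lambda>i\<in>{..<d}. a \<otimes>\<^bsub>R\<^esub> x i)"
  by (auto simp: free_left_module_def)

lemma (in ring) left_module_free: "left_module R (free_left_module R d)"
proof -
  let ?F = "free_left_module R d"
  have cl: "x i \<in> carrier R" if "x \<in> carrier ?F" "i < d" for x i
    using that by (auto simp: free_left_module_simps(1))
  have eqI: "x = y" if "x \<in> carrier ?F" "y \<in> carrier ?F" "\<And>i. i < d \<Longrightarrow> x i = y i" for x y
    using that by (intro PiE_ext[of x "{..<d}" "\<lambda>_. carrier R" y]) (auto simp: free_left_module_simps(1))
  have zero: "\<zero>\<^bsub>?F\<^esub> \<in> carrier ?F"
    by (simp add: free_left_module_simps restrict_PiE_iff)
  have neg: "(\<lambda>i\<in>{..<d}. \<ominus> x i) \<in> carrier ?F" if "x \<in> carrier ?F" for x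
    using cl[OF that] by (simp add: free_left_module_simps restrict_PiE_iff)
  have add: "x \<oplus>\<^bsub>?F\<^esub> y \<in> carrier ?F" if "x \<in> carrier ?F" "y \<in> carrier ?F" for x y
    using cl[OF that(1)] cl[OF that(2)] by (simp add: free_left_module_simps restrict_PiE_iff)
  have smult: "a \<odot>\<^bsub>?F\<^esub> x \<in> carrier ?F" if "a \<in> carrier R" "x \<in> carrier ?F" for a x
    using that(1) cl[OF that(2)] by (simp add: free_left_module_simps restrict_PiE_iff)
  note closed = zero neg add smult
  have app: "(x \<oplus>\<^bsub>?F\<^esub> y) i = x i \<oplus> y i" "(a \<odot>\<^bsub>?F\<^esub> x) i = a \<otimes> x i" "\<zero>\<^bsub>?F\<^esub> i = \<zero>"
    if "i < d" for x y i a
    using that by (simp_all add: free_left_module_simps)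
  have "abelian_group ?F"
  proof (rule abelian_groupI)
    fix x y assume x: "x \<in> carrier ?F" and y: "y \<in> carrier ?F"
    show "x \<oplus>\<^bsub>?F\<^esub> y \<in> carrier ?F" using x y by (rule add)
    show "x \<oplus>\<^bsub>?F\<^esub> y = y \<oplus>\<^bsub>?F\<^esub> x"
      using x y by (intro eqI closed) (simp_all add: app cl a_comm)
    show "x \<oplus>\<^bsub>?F\<^esub> y \<oplus>\<^bsub>?F\<^esub> z = x \<oplus>\<^bsub>?F\<^esub> (y \<oplus>\<^bsub>?F\<^esub> z)" if "z \<in> carrier ?F" for z
      using x y that by (intro eqI closed) (simp_all add: app cl a_assoc)
  next
    show "\<zero>\<^bsub>?F\<^esub> \<in> carrier ?F" by (rule zero)
    fix x assume x: "x \<in> carrier ?F"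
    show "\<zero>\<^bsub>?F\<^esub> \<oplus>\<^bsub>?F\<^esub> x = x"
      using x by (intro eqI closed) (simp_all add: app cl)
    have "(\<lambda>i\<in>{..<d}. \<ominus> x i) \<oplus>\<^bsub>?F\<^esub> x = \<zero>\<^bsub>?F\<^esub>"
      using x by (intro eqI closed) (simp_all add: app cl l_neg)
    then show "\<exists>y\<in>carrier ?F. y \<oplus>\<^bsub>?F\<^esub> x = \<zero>\<^bsub>?F\<^esub>" using neg[OF x] by blast
  qed
  moreover have "left_module_axioms R ?F"
  proof
    fix a x assume a: "a \<in> carrier R" and x: "x \<in> carrier ?F"
    show "a \<odot>\<^bsub>?F\<^esub> x \<in> carrier ?F" using a x by (rule smult)
    show "(a \<oplus> b) \<odot>\<^bsub>?F\<^esub> x = a \<odot>\<^bsub>?F\<^esub> x \<oplus>\<^bsub>?F\<^esub> b \<odot>\<^bsub>?F\<^esub> x" if "b \<in> carrier R" for b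
      using a x that by (intro eqI closed) (simp_all add: app cl l_distr)
    show "(a \<otimes> b) \<odot>\<^bsub>?F\<^esub> x = a \<odot>\<^bsub>?F\<^esub> (b \<odot>\<^bsub>?F\<^esub> x)" if "b \<in> carrier R" for b
      using a x that by (intro eqI closed) (simp_all add: app cl m_assoc)
    show "a \<odot>\<^bsub>?F\<^esub> (x \<oplus>\<^bsub>?F\<^esub> y) = a \<odot>\<^bsub>?F\<^esub> x \<oplus>\<^bsub>?F\<^esub> a \<odot>\<^bsub>?F\<^esub> y" if "y \<in> carrier ?F" for y
      using a x that by (intro eqI closed) (simp_all add: app cl r_distr)
  next
    fix x assume x: "x \<in> carrier ?F"
    show "\<one> \<odot>\<^bsub>?F\<^esub> x = x" using x by (intro eqI closed) (simp_all add: app cl)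
  qed
  ultimately show ?thesis by (simp add: left_module_def ring_axioms)
qed

lemma (in ring) unit_vec_closed: "unit_vec R d i \<in> carrier (free_left_module R d)"
  by (auto simp: unit_vec_def free_left_module_simps)

context left_module
begin

lemma lin_comb_closed:
  assumes "x \<in> {..<d} \<rightarrow> carrier R" "t \<in> {..<d} \<rightarrow> carrier M"
  shows "lin_comb M d x t \<in> carrier M"
  unfolding lin_comb_def using assms by (intro M.finsum_closed) auto

lemma smult_finsum:
  assumes "finite A" "a \<in> carrier R" "f \<in> A \<rightarrow> carrier M"
  shows "a \<odot>\<^bsub>M\<^esub> (\<Oplus>\<^bsub>M\<^esub> i\<in>A. f i) = (\<Oplus>\<^bsub>M\<^esub> i\<in>A. a \<odot>\<^bsub>M\<^esub> f i)"
  using assms(1,3,2)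
proof (induction A rule: finite_induct)
  case (insert i A)
  then show ?case
    by (subst (1 2) M.finsum_insert) (auto simp: smult_r_distr Pi_iff)
qed simp

lemma mod_hom_lin_comb:
  assumes t: "t \<in> {..<d} \<rightarrow> carrier M"
  shows "mod_hom R (free_left_module R d) M (\<lambda>x. lin_comb M d x t)"
  unfolding mod_hom_def
proof (intro conjI ballI)
  let ?F = "free_left_module R d"
  have tc: "t i \<in> carrier M" if "i < d" for i using t that by auto
  have cl: "x i \<in> carrier R" if "x \<in> carrier ?F" "i < d" for x i
    using that by (auto simp: free_left_module_simps)
  show "(\<lambda>x. lin_comb M d x t) \<in> carrier ?F \<rightarrow> carrier M"
    using t by (auto simp: cl intro!: lin_comb_closed)
  fix x assume x: "x \<in> carrier ?F"
  {
    fix y assume y: "y \<in> carrier ?F"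
    have "lin_comb M d (x \<oplus>\<^bsub>?F\<^esub> y) t = (\<Oplus>\<^bsub>M\<^esub> i\<in>{..<d}. x i \<odot>\<^bsub>M\<^esub> t i \<oplus>\<^bsub>M\<^esub> y i \<odot>\<^bsub>M\<^esub> t i)"
      unfolding lin_comb_def using x y
      by (intro M.finsum_cong') (auto simp: free_left_module_simps(3) smult_l_distr cl tc)
    also have "\<dots> = lin_comb M d x t \<oplus>\<^bsub>M\<^esub> lin_comb M d y t"
      unfolding lin_comb_def using x y by (intro M.finsum_addf) (auto simp: cl tc)
    finally show "lin_comb M d (x \<oplus>\<^bsub>?F\<^esub> y) t = lin_comb M d x t \<oplus>\<^bsub>M\<^esub> lin_comb M d y t" .
  }
  fix a assume a: "a \<in> carrier R"
  have "a \<odot>\<^bsub>M\<^esub> lin_comb M d x t = (\<Oplus>\<^bsub>M\<^esub> i\<in>{..<d}. a \<odot>\<^bsub>M\<^esub> (x i \<odot>\<^bsub>M\<^esub> t i))"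
    unfolding lin_comb_def using a x by (intro smult_finsum) (auto simp: cl tc)
  also have "\<dots> = lin_comb M d (a \<odot>\<^bsub>?F\<^esub> x) t"
    unfolding lin_comb_def using a x
    by (intro M.finsum_cong') (auto simp: free_left_module_simps(4) smult_assoc cl tc)
  finally show "lin_comb M d (a \<odot>\<^bsub>?F\<^esub> x) t = a \<odot>\<^bsub>M\<^esub> lin_comb M d x t" by simp
qed

lemma lin_comb_unit_vec:
  assumes t: "t \<in> {..<d} \<rightarrow> carrier M" and i: "i < d"
  shows "lin_comb M d (unit_vec R d i) t = t i"
proof -
  have "lin_comb M d (unit_vec R d i) t = (\<Oplus>\<^bsub>M\<^esub> j\<in>{..<d}. if i = j then t j else \<zero>\<^bsub>M\<^esub>)"
    unfolding lin_comb_def using t by (intro M.finsum_cong') (auto simp: unit_vec_def Pi_iff)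
  also have "\<dots> = t i" using t i by (intro M.finsum_singleton) auto
  finally show ?thesis .
qed

lemma mod_hom_free_eq_lin_comb:
  assumes g: "mod_hom R (free_left_module R d) M g" and x: "x \<in> carrier (free_left_module R d)"
  shows "g x = lin_comb M d x (\<lambda>i. g (unit_vec R d i))"
proof -
  let ?F = "free_left_module R d"
  interpret F: left_module R ?F by (rule R.left_module_free)
  have cl: "x i \<in> carrier R" if "i < d" for i
    using x that by (auto simp: free_left_module_simps)
  \<comment> \<open>\<open>x' k\<close> is \<open>x\<close> with all coordinates from the \<open>k\<close>-th on replaced by zero\<close>
  define x' where "x' k = (\<lambda>j\<in>{..<d}. if j < k then x j else \<zero>\<^bsub>R\<^esub>)" for k
  have x': "x' k \<in> carrier ?F" for k
    by (auto simp: x'_def free_left_module_simps cl)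
  have e: "g (unit_vec R d i) \<in> carrier M" for i
    using mod_homD(1)[OF g] R.unit_vec_closed by blast
  have "g (x' k) = (\<Oplus>\<^bsub>M\<^esub> i\<in>{..<k}. x i \<odot>\<^bsub>M\<^esub> g (unit_vec R d i))" if "k \<le> d" for k
    using that
  proof (induction k)
    case 0
    have "x' 0 = \<zero>\<^bsub>?F\<^esub>" by (simp add: x'_def free_left_module_simps)
    then show ?case using F.mod_hom_zero[OF left_module_axioms g] by simp
  next
    case (Suc k)
    have "x' (Suc k) = x k \<odot>\<^bsub>?F\<^esub> unit_vec R d k \<oplus>\<^bsub>?F\<^esub> x' k"
      using Suc.prems by (auto simp: x'_def free_left_module_simps unit_vec_def cl less_Suc_eq
          intro!: restrict_ext)
    then have "g (x' (Suc k)) = x k \<odot>\<^bsub>M\<^esub> g (unit_vec R d k) \<oplus>\<^bsub>M\<^esub> g (x' k)"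
      using Suc.prems x' cl R.unit_vec_closed by (simp add: mod_homD[OF g])
    also have "\<dots> = (\<Oplus>\<^bsub>M\<^esub> i\<in>{..<Suc k}. x i \<odot>\<^bsub>M\<^esub> g (unit_vec R d i))"
      using Suc cl e by (simp add: lessThan_Suc)
    finally show ?case .
  qed
  moreover have "x' d = x"
    using x by (auto simp: x'_def free_left_module_simps PiE_def extensional_def fun_eq_iff)
  ultimately show ?thesis by (metis lin_comb_def order_refl)
qed

lemma mod_hom_free_determined:
  assumes "mod_hom R (free_left_module R d) M g" "mod_hom R (free_left_module R d) M g'"
    and "\<And>i. i < d \<Longrightarrow> g (unit_vec R d i) = g' (unit_vec R d i)"
    and x: "x \<in> carrier (free_left_module R d)"
  shows "g x = g' x"
proof -
  have "x i \<in> carrier R" if "i < d" for i using that x by (auto simp: free_left_module_simps)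
  then have "lin_comb M d x (\<lambda>i. g (unit_vec R d i)) = lin_comb M d x (\<lambda>i. g' (unit_vec R d i))"
    unfolding lin_comb_def using assms(3) mod_homD(1)[OF assms(2) R.unit_vec_closed]
    by (intro M.finsum_cong') auto
  then show ?thesis using assms by (metis mod_hom_free_eq_lin_comb)
qed

text \<open>
  Sending a pair of \<open>E \<subseteq> R\<^sup>d\<close> and an isomorphism \<open>h: R\<^sup>d/E \<rightarrow> M\<close> to the images under \<open>h\<close> of the classes
  of the standard basis vectors is a bijection onto the generating tuples. For fixed \<open>E\<close> there are
  either \<open>|Aut M|\<close> choices of \<open>h\<close> or none.\<close>

lemma card_gen_tuples:
  fixes d :: nat
  assumes fin: "finite (carrier M)"
  defines "F \<equiv> free_left_module R d"
  defines "Q \<equiv> {E. submodule E R F \<and> mod_isomorphic R (quotient_module F E) M}"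
  shows "finite Q" and "card (gen_tuples R M d) = card Q * card (mod_auts R M)"
proof -
  interpret F: left_module R F unfolding F_def by (rule R.left_module_free)
  let ?P = "SIGMA E:Q. mod_isos R (quotient_module F E) M"
  let ?e = "unit_vec R d"
  define \<Phi> where "\<Phi> = (\<lambda>(E, h). \<lambda>i\<in>{..<d}. h (E +>\<^bsub>F\<^esub> ?e i) :: 'b)"
  have e: "?e i \<in> carrier F" for i unfolding F_def by (rule R.unit_vec_closed)
  note epi = F.epimorphism_of_mod_iso[OF left_module_axioms]
  have inj: "inj_on \<Phi> ?P"
  proof (rule inj_onI, clarify)
    fix E h E' h'
    assume E: "E \<in> Q" "E' \<in> Q" and h: "h \<in> mod_isos R (quotient_module F E) M"
      "h' \<in> mod_isos R (quotient_module F E') M" and eq: "\<Phi> (E, h) = \<Phi> (E', h')"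
    have sub: "submodule E R F" "submodule E' R F" using E by (auto simp: Q_def)
    have same: "h (E +>\<^bsub>F\<^esub> x) = h' (E' +>\<^bsub>F\<^esub> x)" if "x \<in> carrier F" for x
    proof (rule mod_hom_free_determined)
      show "mod_hom R (free_left_module R d) M (\<lambda>x. h (E +>\<^bsub>F\<^esub> x))"
        "mod_hom R (free_left_module R d) M (\<lambda>x. h' (E' +>\<^bsub>F\<^esub> x))"
        using epi(1) sub h unfolding F_def by blast+
      show "x \<in> carrier (free_left_module R d)" using that by (simp add: F_def)
      show "h (E +>\<^bsub>F\<^esub> ?e i) = h' (E' +>\<^bsub>F\<^esub> ?e i)" if "i < d" for i
        using fun_cong[OF eq, of i] that by (simp add: \<Phi>_def)
    qed
    have "E = {x \<in> carrier F. h (E +>\<^bsub>F\<^esub> x) = \<zero>\<^bsub>M\<^esub>}" using epi(3) sub h by blast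
    also have "\<dots> = {x \<in> carrier F. h' (E' +>\<^bsub>F\<^esub> x) = \<zero>\<^bsub>M\<^esub>}" using same by auto
    also have "\<dots> = E'" using epi(3) sub h by blast
    finally have EE: "E = E'" .
    moreover have "h = h'"
    proof (rule extensionalityI)
      show "h \<in> extensional (carrier (quotient_module F E))" "h' \<in> extensional (carrier (quotient_module F E))"
        using h EE by (auto simp: mod_isos_iff)
      show "h C = h' C" if "C \<in> carrier (quotient_module F E)" for C
      proof -
        obtain x where "x \<in> carrier F" "C = E +>\<^bsub>F\<^esub> x"
          using \<open>C \<in> carrier (quotient_module F E)\<close> by (auto simp: F.quotient_module_simps(1)[OF sub(1)])
        then show "h C = h' C" using same EE by simp
      qed
    qed
    ultimately show "E = E' \<and> h = h'" by simp
  qed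
  have img: "\<Phi> ` ?P = gen_tuples R M d"
  proof (intro equalityI subsetI)
    fix t assume "t \<in> \<Phi> ` ?P"
    then obtain E h where sub: "submodule E R F" and h: "h \<in> mod_isos R (quotient_module F E) M"
      and t: "t = \<Phi> (E, h)" by (auto simp: Q_def)
    let ?g = "\<lambda>x. h (E +>\<^bsub>F\<^esub> x)"
    note g = epi[OF sub h]
    have tc: "t \<in> {..<d} \<rightarrow>\<^sub>E carrier M" using mod_homD(1)[OF g(1)] e by (auto simp: t \<Phi>_def)
    have "lin_comb M d x t = ?g x" if x: "x \<in> carrier F" for x
    proof (rule mod_hom_free_determined)
      show "mod_hom R (free_left_module R d) M (\<lambda>x. lin_comb M d x t)"
        using tc by (intro mod_hom_lin_comb) auto
      show "mod_hom R (free_left_module R d) M ?g" using g(1) by (simp add: F_def)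
      show "lin_comb M d (?e i) t = ?g (?e i)" if "i < d" for i
        using lin_comb_unit_vec[OF _ that, of t] tc that by (auto simp: t \<Phi>_def)
    qed (use x in \<open>simp add: F_def\<close>)
    then have "(\<lambda>x. lin_comb M d x t) ` carrier F = carrier M" using g(2) by (simp cong: image_cong)
    then show "t \<in> gen_tuples R M d" using tc by (simp add: gen_tuples_def F_def)
  next
    fix t assume "t \<in> gen_tuples R M d"
    then have t: "t \<in> {..<d} \<rightarrow>\<^sub>E carrier M" and surj: "(\<lambda>x. lin_comb M d x t) ` carrier F = carrier M"
      by (auto simp: gen_tuples_def F_def)
    let ?g = "\<lambda>x. lin_comb M d x t"
    have g: "mod_hom R F M ?g" unfolding F_def using t by (intro mod_hom_lin_comb) auto
    define E where "E = {x \<in> carrier F. ?g x = \<zero>\<^bsub>M\<^esub>}"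
    note mi = F.mod_iso_of_epimorphism[OF left_module_axioms g surj, folded E_def]
    obtain h where h: "h \<in> mod_isos R (quotient_module F E) M" "\<forall>x\<in>carrier F. h (E +>\<^bsub>F\<^esub> x) = ?g x"
      using mi(2) by blast
    have "(E, h) \<in> ?P" using mi(1) h(1) by (auto simp: Q_def mod_isomorphic_def)
    moreover have "\<Phi> (E, h) = t"
    proof (rule extensionalityI)
      show "\<Phi> (E, h) \<in> extensional {..<d}" by (simp add: \<Phi>_def)
      show "t \<in> extensional {..<d}" using t by (simp add: PiE_def)
      show "\<Phi> (E, h) i = t i" if "i \<in> {..<d}" for i
        using that h(2) e t lin_comb_unit_vec[of t d i] by (auto simp: \<Phi>_def)
    qed
    ultimately show "t \<in> \<Phi> ` ?P" by (metis imageI)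
  qed
  have fin_gen: "finite (gen_tuples R M d)"
    using finite_PiE[of "{..<d}" "\<lambda>_. carrier M"] fin
    by (auto simp: gen_tuples_def)
  have finP: "finite ?P" using inj img fin_gen by (metis finite_imageD)
  have "Q \<subseteq> fst ` ?P" by (force simp: Q_def mod_isomorphic_def)
  then show finQ: "finite Q" using finP by (meson finite_imageI finite_subset)
  have card_iso: "card (mod_isos R (quotient_module F E) M) = card (mod_auts R M)"
    and fin_iso: "finite (mod_isos R (quotient_module F E) M)" if "E \<in> Q" for E
  proof -
    have sub: "submodule E R F" and iso: "mod_isomorphic R (quotient_module F E) M"
      using that by (auto simp: Q_def)
    show "card (mod_isos R (quotient_module F E) M) = card (mod_auts R M)"
      using iso ops_closed left_module.ops_closed[OF F.left_module_quotient[OF sub]]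
      by (intro card_mod_isos)
    then show "finite (mod_isos R (quotient_module F E) M)"
      using card_mod_auts_pos[OF ops_closed fin] by (metis card.infinite less_irrefl)
  qed
  have "card (gen_tuples R M d) = card ?P" using inj img by (metis card_image)
  also have "\<dots> = card Q * card (mod_auts R M)"
    using finQ card_iso fin_iso by (subst card_SigmaI) auto
  finally show "card (gen_tuples R M d) = card Q * card (mod_auts R M)" .
qed

end

section \<open>Maximal submodules of a finite module\<close>

text \<open>The fibres of \<open>H \<times> K \<rightarrow> H + K\<close>, \<open>(h, k) \<mapsto> h + k\<close>, are the cosets of a copy of \<open>H \<inter> K\<close>.\<close>

lemma (in abelian_group) card_set_add:
  assumes fin: "finite (carrier G)" and H: "additive_subgroup H G" and K: "additive_subgroup K G"
    and sum: "H <+> K = carrier G"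
  shows "card H * card K = card (carrier G) * card (H \<inter> K)"
proof -
  interpret H: additive_subgroup H G by fact
  interpret K: additive_subgroup K G by fact
  have finHK: "finite H" "finite K"
    using fin H.a_subset K.a_subset by (auto intro: finite_subset)
  have fibre: "card {p \<in> H \<times> K. fst p \<oplus> snd p = z} = card (H \<inter> K)" if "z \<in> carrier G" for z
  proof -
    have "z \<in> H <+> K" using that sum by simp
    then obtain h k where hk: "h \<in> H" "k \<in> K" "z = h \<oplus> k"
      by (auto simp: set_add_def')
    have hkc: "h \<in> carrier G" "k \<in> carrier G" using hk by auto
    have "bij_betw (\<lambda>c. (h \<oplus> c, k \<ominus> c)) (H \<inter> K) {p \<in> H \<times> K. fst p \<oplus> snd p = z}"
      unfolding bij_betw_def
    proof (intro conjI equalityI subsetI)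
      show "inj_on (\<lambda>c. (h \<oplus> c, k \<ominus> c)) (H \<inter> K)"
        using hkc by (auto simp: inj_on_def)
      fix p assume p: "p \<in> (\<lambda>c. (h \<oplus> c, k \<ominus> c)) ` (H \<inter> K)"
      then obtain c where c: "c \<in> H" "c \<in> K" "p = (h \<oplus> c, k \<ominus> c)" by auto
      have cc: "c \<in> carrier G" using c by auto
      have "k \<ominus> c = \<ominus> c \<oplus> k" using hkc cc by (simp add: a_minus_def a_comm)
      then have "h \<oplus> c \<oplus> (k \<ominus> c) = h \<oplus> k"
        using hkc cc by (simp add: a_assoc r_neg2)
      moreover have "k \<ominus> c \<in> K" using hk c by (simp add: a_minus_def)
      ultimately show "p \<in> {p \<in> H \<times> K. fst p \<oplus> snd p = z}" using c hk by auto
    next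
      fix p assume "p \<in> {p \<in> H \<times> K. fst p \<oplus> snd p = z}"
      then obtain a b where ab: "p = (a, b)" "a \<in> H" "b \<in> K" "a \<oplus> b = h \<oplus> k"
        using hk by (cases p) auto
      have abc: "a \<in> carrier G" "b \<in> carrier G" using ab by auto
      have "\<ominus> h \<oplus> a = \<ominus> h \<oplus> (a \<oplus> b) \<oplus> \<ominus> b"
        using abc hkc by (simp add: a_assoc r_neg)
      also have "\<dots> = k \<oplus> \<ominus> b"
        using abc hkc by (simp add: ab(4) a_assoc r_neg1)
      finally have c: "\<ominus> h \<oplus> a = k \<oplus> \<ominus> b" .
      have "\<ominus> h \<oplus> a \<in> H" using hk ab by auto
      moreover have "k \<oplus> \<ominus> b \<in> K" using hk ab by auto
      moreover have "h \<oplus> (\<ominus> h \<oplus> a) = a" using hkc abc by (simp add: r_neg2)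
      moreover have "k \<ominus> (k \<oplus> \<ominus> b) = b"
        using hkc abc by (simp add: a_minus_def minus_add r_neg2)
      ultimately show "p \<in> (\<lambda>c. (h \<oplus> c, k \<ominus> c)) ` (H \<inter> K)"
        using c ab by (intro image_eqI[of _ _ "\<ominus> h \<oplus> a"]) auto
    qed
    then show ?thesis by (rule bij_betw_same_card[symmetric])
  qed
  have "H \<times> K = (\<Union>z\<in>carrier G. {p \<in> H \<times> K. fst p \<oplus> snd p = z})" by auto
  then have "card H * card K = card (\<Union>z\<in>carrier G. {p \<in> H \<times> K. fst p \<oplus> snd p = z})"
    by (metis card_cartesian_product)
  also have "\<dots> = (\<Sum>z\<in>carrier G. card {p \<in> H \<times> K. fst p \<oplus> snd p = z})"
    using fin finHK by (intro card_UN_disjoint) auto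
  also have "\<dots> = card (carrier G) * card (H \<inter> K)" using fibre by simp
  finally show ?thesis .
qed

lemma (in abelian_group) card_proper_subgroup:
  assumes fin: "finite (carrier G)" and H: "additive_subgroup H G" and ne: "H \<noteq> carrier G"
  shows "2 * card H \<le> card (carrier G)"
proof -
  interpret H: additive_subgroup H G by fact
  have l: "card (a_rcosets H) * card H = card (carrier G)"
    using a_lagrange[OF fin H] by (simp add: order_def)
  have "card H < card (carrier G)"
    using ne fin H.a_subset by (intro psubset_card_mono) auto
  with l have "card (a_rcosets H) \<noteq> 0" "card (a_rcosets H) \<noteq> 1"
    by (metis mult_0 not_less_zero, metis mult_1 less_irrefl)
  then have "2 \<le> card (a_rcosets H)" by linarith
  with l show ?thesis by (metis mult_le_mono1)
qed

text \<open>The functions \<open>h K = 1\<^sub>K / |K| - 1 / n\<close> on the group are pairwise orthogonal by \<open>card_set_add\<close>, and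
  \<open>h K\<close> has squared norm \<open>1 / |K| - 1 / n\<close>, which is also its value at zero. So
  for the sum \<open>V\<close> of these numbers, the function \<open>\<Sum>K. h K\<close> has squared norm \<open>V\<close> and value \<open>V\<close> at zero,
  whence \<open>V\<^sup>2 \<le> V\<close> and \<open>V \<le> 1\<close>. As \<open>|K| \<le> n / 2\<close>, each summand of \<open>V\<close> is at least \<open>1 / n\<close>.\<close>

lemma (in abelian_group) card_independent_subgroups_le:
  assumes fin: "finite (carrier G)"
    and sub: "\<And>K. K \<in> \<K> \<Longrightarrow> additive_subgroup K G"
    and proper: "\<And>K. K \<in> \<K> \<Longrightarrow> K \<noteq> carrier G"
    and sum: "\<And>K L. \<lbrakk>K \<in> \<K>; L \<in> \<K>; K \<noteq> L\<rbrakk> \<Longrightarrow> K <+> L = carrier G"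
  shows "card \<K> \<le> card (carrier G)"
proof -
  define n where "n = real (card (carrier G))"
  have n: "n > 0" unfolding n_def using fin by (auto simp: card_gt_0_iff)
  have Ksub: "K \<subseteq> carrier G" and K0: "\<zero> \<in> K" if "K \<in> \<K>" for K
    using sub[OF that] by (auto simp: additive_subgroup.a_subset additive_subgroup.zero_closed)
  have fK: "finite K" if "K \<in> \<K>" for K using Ksub[OF that] fin by (rule finite_subset)
  have finK: "finite \<K>"
    using Ksub fin by (intro finite_subset[of \<K> "Pow (carrier G)"]) auto
  have Kpos: "real (card K) > 0" if "K \<in> \<K>" for K
    using K0[OF that] fK[OF that] by (auto simp: card_gt_0_iff)
  define h where "h K x = indicator K x / real (card K) - 1 / n" for K and x :: 'a
  define V where "V = (\<Sum>K\<in>\<K>. 1 / real (card K) - 1 / n)"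
  have inner: "(\<Sum>x\<in>carrier G. h K x * h L x) = (if K = L then 1 / real (card K) - 1 / n else 0)"
    if K: "K \<in> \<K>" and L: "L \<in> \<K>" for K L
  proof -
    have ind: "(\<Sum>x\<in>carrier G. indicator A x) = real (card A)" if "A \<subseteq> carrier G" for A
      using that fin by (simp add: indicator_def of_bool_def sum.If_cases Int_absorb1)
    have "(\<Sum>x\<in>carrier G. h K x * h L x) =
      (\<Sum>x\<in>carrier G. indicator (K \<inter> L) x / (real (card K) * real (card L))
         - indicator K x / (real (card K) * n) - indicator L x / (real (card L) * n) + 1 / (n * n))"
      unfolding h_def by (intro sum.cong refl) (simp add: indicator_inter_arith algebra_simps)
    also have "\<dots> = real (card (K \<inter> L)) / (real (card K) * real (card L))
         - real (card K) / (real (card K) * n) - real (card L) / (real (card L) * n) + n / (n * n)"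
      using Ksub[OF K] Ksub[OF L]
      by (simp add: sum.distrib sum_subtractf ind le_infI1 n_def flip: sum_divide_distrib)
    also have "\<dots> = real (card (K \<inter> L)) / (real (card K) * real (card L)) - 1 / n"
      using n Kpos[OF K] Kpos[OF L] by simp
    finally have *: "(\<Sum>x\<in>carrier G. h K x * h L x)
      = real (card (K \<inter> L)) / (real (card K) * real (card L)) - 1 / n" .
    show ?thesis
    proof (cases "K = L")
      case True
      then show ?thesis using * Kpos[OF K] by simp
    next
      case False
      have prod: "real (card K) * real (card L) = n * real (card (K \<inter> L))"
        unfolding n_def using card_set_add[OF fin sub[OF K] sub[OF L] sum[OF K L False]]
        by (metis of_nat_mult)
      moreover have "real (card K) * real (card L) > 0"
        using Kpos[OF K] Kpos[OF L] by (rule mult_pos_pos)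
      ultimately have "real (card (K \<inter> L)) \<noteq> 0" by (auto simp: zero_less_mult_iff)
      then have "real (card (K \<inter> L)) / (real (card K) * real (card L)) = 1 / n"
        unfolding prod using n by simp
      then show ?thesis using * False by simp
    qed
  qed
  have "V = (\<Sum>K\<in>\<K>. h K \<zero>)" unfolding V_def h_def by (intro sum.cong) (auto simp: K0)
  then have "V\<^sup>2 = (\<Sum>K\<in>\<K>. h K \<zero>)\<^sup>2" by simp
  also have "\<dots> \<le> (\<Sum>x\<in>carrier G. (\<Sum>K\<in>\<K>. h K x)\<^sup>2)"
    using fin by (intro member_le_sum) auto
  also have "\<dots> = (\<Sum>K\<in>\<K>. \<Sum>L\<in>\<K>. \<Sum>x\<in>carrier G. h K x * h L x)"
    unfolding power2_eq_square sum_product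
    by (subst sum.swap, intro sum.cong refl, subst sum.swap, rule refl)
  also have "\<dots> = V"
    unfolding V_def using finK by (simp add: inner cong: sum.cong)
  finally have "V * V \<le> V * 1" by (simp add: power2_eq_square)
  then have V1: "V \<le> 1" by (cases "V > 0") (auto simp: mult_le_cancel_left)
  have "1 / n \<le> 1 / real (card K) - 1 / n" if K: "K \<in> \<K>" for K
  proof -
    have "2 * real (card K) \<le> n"
      unfolding n_def using card_proper_subgroup[OF fin sub[OF K] proper[OF K]] by linarith
    then have "2 / n \<le> 1 / real (card K)" using n Kpos[OF K] by (simp add: field_simps)
    then show ?thesis by simp
  qed
  then have "(\<Sum>K\<in>\<K>. 1 / n) \<le> V" unfolding V_def by (rule sum_mono)
  with V1 have "real (card \<K>) / n \<le> 1" by simp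
  then have "real (card \<K>) \<le> n" using n by (simp add: divide_le_eq)
  then show ?thesis by (simp add: n_def)
qed

text \<open>The maximal proper submodules of \<open>M\<close>.\<close>

definition max_submodules :: "('a, 'e) ring_scheme \<Rightarrow> ('a, 'b, 'k) module_scheme \<Rightarrow> 'b set set"
  where "max_submodules R M = {K. submodule K R M \<and> K \<noteq> carrier M \<and>
    (\<forall>L. submodule L R M \<longrightarrow> K \<subseteq> L \<longrightarrow> L = K \<or> L = carrier M)}"

context left_module
begin

lemma submodule_set_add:
  assumes H: "submodule H R M" and K: "submodule K R M"
  shows "submodule (H <+>\<^bsub>M\<^esub> K) R M" and "H \<subseteq> H <+>\<^bsub>M\<^esub> K" and "K \<subseteq> H <+>\<^bsub>M\<^esub> K"
proof -
  note HD = submoduleD[OF H] and KD = submoduleD[OF K]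
  have c: "h \<in> carrier M" "k \<in> carrier M" if "h \<in> H" "k \<in> K" for h k
    using that HD(1) KD(1) by auto
  have mem: "z \<in> H <+>\<^bsub>M\<^esub> K \<longleftrightarrow> (\<exists>h\<in>H. \<exists>k\<in>K. z = h \<oplus>\<^bsub>M\<^esub> k)" for z
    by (auto simp: set_add_def')
  show "H \<subseteq> H <+>\<^bsub>M\<^esub> K"
  proof
    fix h assume h: "h \<in> H"
    then have "h = h \<oplus>\<^bsub>M\<^esub> \<zero>\<^bsub>M\<^esub>" using HD(1) by auto
    then show "h \<in> H <+>\<^bsub>M\<^esub> K" unfolding mem using h KD(2) by blast
  qed
  show KS: "K \<subseteq> H <+>\<^bsub>M\<^esub> K"
  proof
    fix k assume k: "k \<in> K"
    then have "k = \<zero>\<^bsub>M\<^esub> \<oplus>\<^bsub>M\<^esub> k" using KD(1) by auto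
    then show "k \<in> H <+>\<^bsub>M\<^esub> K" unfolding mem using k HD(2) by blast
  qed
  show "submodule (H <+>\<^bsub>M\<^esub> K) R M"
  proof (rule submoduleI')
    show "H <+>\<^bsub>M\<^esub> K \<subseteq> carrier M" using c by (auto simp: mem)
    show "\<zero>\<^bsub>M\<^esub> \<in> H <+>\<^bsub>M\<^esub> K" using KS KD(2) by blast
  next
    fix x y assume "x \<in> H <+>\<^bsub>M\<^esub> K" "y \<in> H <+>\<^bsub>M\<^esub> K"
    then obtain h k h' k' where *: "h \<in> H" "k \<in> K" "x = h \<oplus>\<^bsub>M\<^esub> k"
      "h' \<in> H" "k' \<in> K" "y = h' \<oplus>\<^bsub>M\<^esub> k'" by (auto simp: mem)
    then have "x \<oplus>\<^bsub>M\<^esub> y = (h \<oplus>\<^bsub>M\<^esub> h') \<oplus>\<^bsub>M\<^esub> (k \<oplus>\<^bsub>M\<^esub> k')"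
      using c by (simp add: M.add.m_ac)
    then show "x \<oplus>\<^bsub>M\<^esub> y \<in> H <+>\<^bsub>M\<^esub> K" unfolding mem using * HD(4) KD(4) by blast
  next
    fix a x assume a: "a \<in> carrier R" and "x \<in> H <+>\<^bsub>M\<^esub> K"
    then obtain h k where *: "h \<in> H" "k \<in> K" "x = h \<oplus>\<^bsub>M\<^esub> k" by (auto simp: mem)
    then have "a \<odot>\<^bsub>M\<^esub> x = a \<odot>\<^bsub>M\<^esub> h \<oplus>\<^bsub>M\<^esub> a \<odot>\<^bsub>M\<^esub> k" using a c by (simp add: smult_r_distr)
    then show "a \<odot>\<^bsub>M\<^esub> x \<in> H <+>\<^bsub>M\<^esub> K" unfolding mem using * a HD(5) KD(5) by blast
  qed
qed

lemma card_max_submodules_le: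
  assumes fin: "finite (carrier M)"
  shows "card (max_submodules R M) \<le> card (carrier M)"
proof (rule M.card_independent_subgroups_le[OF fin])
  fix K assume K: "K \<in> max_submodules R M"
  then have sK: "submodule K R M" and "K \<noteq> carrier M" by (auto simp: max_submodules_def)
  then show "K \<noteq> carrier M" by simp
  show "additive_subgroup K M"
    using submoduleD(6)[OF sK] by (simp add: abelian_subgroup_def)
  fix L assume L: "L \<in> max_submodules R M" and "K \<noteq> L"
  then have sL: "submodule L R M" by (auto simp: max_submodules_def)
  note s = submodule_set_add[OF sK sL]
  show "K <+>\<^bsub>M\<^esub> L = carrier M"
  proof (rule ccontr)
    assume "K <+>\<^bsub>M\<^esub> L \<noteq> carrier M"
    then have "K <+>\<^bsub>M\<^esub> L = K" "K <+>\<^bsub>M\<^esub> L = L"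
      using s K L by (auto simp: max_submodules_def)
    with \<open>K \<noteq> L\<close> show False by simp
  qed
qed

lemma exists_max_submodule:
  assumes fin: "finite (carrier M)" and W: "submodule W R M" "W \<noteq> carrier M"
  shows "\<exists>K\<in>max_submodules R M. W \<subseteq> K"
proof -
  let ?A = "{K. submodule K R M \<and> K \<noteq> carrier M}"
  have "finite ?A"
    using fin by (rule finite_subset[rotated, OF finite_Pow_iff[THEN iffD2]]) (auto dest: submoduleD(1))
  moreover have "W \<in> ?A" using W by simp
  ultimately have "\<exists>K\<in>?A. W \<subseteq> K \<and> (\<forall>L\<in>?A. K \<subseteq> L \<longrightarrow> K = L)"
    by (rule finite_has_maximal2)
  then obtain K where K: "K \<in> ?A" and max: "W \<subseteq> K \<and> (\<forall>L\<in>?A. K \<subseteq> L \<longrightarrow> K = L)"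
    by (rule bexE)
  have "L = K \<or> L = carrier M" if "submodule L R M" "K \<subseteq> L" for L
    using that max by auto
  with K have "K \<in> max_submodules R M" unfolding max_submodules_def by simp
  with max show ?thesis by (intro bexI[of _ K]) simp_all
qed

lemma submodule_image_mod_hom:
  assumes F: "left_module R F" and g: "mod_hom R F M g"
  shows "submodule (g ` carrier F) R M"
proof -
  interpret F: left_module R F by fact
  note gD = mod_homD[OF g] F.mod_hom_zero[OF left_module_axioms g]
  show ?thesis
  proof (rule submoduleI')
    show "\<zero>\<^bsub>M\<^esub> \<in> g ` carrier F" using gD(4) by (metis F.M.zero_closed imageI)
    show "x \<oplus>\<^bsub>M\<^esub> y \<in> g ` carrier F" if "x \<in> g ` carrier F" "y \<in> g ` carrier F" for x y
      using that by (auto simp flip: gD(2))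
    show "a \<odot>\<^bsub>M\<^esub> x \<in> g ` carrier F" if "a \<in> carrier R" "x \<in> g ` carrier F" for a x
      using that by (auto simp flip: gD(3))
  qed (use gD in auto)
qed

lemma gen_tuples_subset: "gen_tuples R M d \<subseteq> {..<d} \<rightarrow>\<^sub>E carrier M"
  by (auto simp: gen_tuples_def)

lemma nongen_tuple_in_max_submodule:
  assumes fin: "finite (carrier M)" and t: "t \<in> {..<d} \<rightarrow>\<^sub>E carrier M" "t \<notin> gen_tuples R M d"
  shows "\<exists>K\<in>max_submodules R M. t \<in> {..<d} \<rightarrow>\<^sub>E K"
proof -
  let ?F = "free_left_module R d" and ?g = "\<lambda>x. lin_comb M d x t"
  have tc: "t \<in> {..<d} \<rightarrow> carrier M" using t by auto
  then have g: "mod_hom R ?F M ?g" by (rule mod_hom_lin_comb)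
  have "submodule (?g ` carrier ?F) R M"
    by (rule submodule_image_mod_hom[OF R.left_module_free g])
  moreover have "?g ` carrier ?F \<noteq> carrier M" using t by (simp add: gen_tuples_def)
  ultimately have "\<exists>K\<in>max_submodules R M. ?g ` carrier ?F \<subseteq> K"
    by (rule exists_max_submodule[OF fin])
  then obtain K where K: "K \<in> max_submodules R M" "?g ` carrier ?F \<subseteq> K"
    by (rule bexE)
  have "t i \<in> K" if "i < d" for i
  proof -
    have "t i = ?g (unit_vec R d i)" by (rule lin_comb_unit_vec[OF tc that, symmetric])
    also have "\<dots> \<in> ?g ` carrier ?F" by (intro imageI R.unit_vec_closed)
    finally show ?thesis using K(2) by (rule subsetD[rotated])
  qed
  then have "t \<in> {..<d} \<rightarrow>\<^sub>E K" using t by auto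
  with K(1) show ?thesis by (rule bexI[rotated])
qed

lemma card_nongen_tuples_le:
  assumes fin: "finite (carrier M)"
  defines "n \<equiv> real (card (carrier M))"
  shows "n ^ d - real (card (gen_tuples R M d)) \<le> 2 * n * ln n * (n / 2) ^ d"
proof -
  let ?T = "{..<d} \<rightarrow>\<^sub>E carrier M"
  have finT: "finite ?T" using fin by (intro finite_PiE) auto
  have cardT: "card ?T = card (carrier M) ^ d" by (simp add: card_PiE)
  have "real (card ?T) - real (card (gen_tuples R M d)) = real (card (?T - gen_tuples R M d))"
    using finT gen_tuples_subset by (subst card_Diff_subset) (auto intro: finite_subset simp: card_mono of_nat_diff)
  then have nongen: "n ^ d - real (card (gen_tuples R M d)) = real (card (?T - gen_tuples R M d))"
    by (simp add: cardT n_def)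
  have Kd: "submodule K R M" "K \<noteq> carrier M" if "K \<in> max_submodules R M" for K
    using that by (auto simp: max_submodules_def)
  have finmax: "finite (max_submodules R M)"
    using fin Kd(1) by (intro finite_subset[of "max_submodules R M" "Pow (carrier M)"]) (auto dest: submoduleD(1))
  have "card (?T - gen_tuples R M d) \<le> card (\<Union>K\<in>max_submodules R M. {..<d} \<rightarrow>\<^sub>E K)"
  proof (rule card_mono)
    show "finite (\<Union>K\<in>max_submodules R M. {..<d} \<rightarrow>\<^sub>E K)"
      using finmax submoduleD(1)[OF Kd(1)] fin by (auto intro!: finite_PiE intro: finite_subset)
    show "?T - gen_tuples R M d \<subseteq> (\<Union>K\<in>max_submodules R M. {..<d} \<rightarrow>\<^sub>E K)"
    proof
      fix t assume "t \<in> ?T - gen_tuples R M d"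
      then have "t \<in> ?T" "t \<notin> gen_tuples R M d" by simp_all
      then show "t \<in> (\<Union>K\<in>max_submodules R M. {..<d} \<rightarrow>\<^sub>E K)"
        unfolding UN_iff by (rule nongen_tuple_in_max_submodule[OF fin])
    qed
  qed
  also have "\<dots> \<le> (\<Sum>K\<in>max_submodules R M. card ({..<d} \<rightarrow>\<^sub>E K))"
    using finmax by (rule card_UN_le)
  finally have "real (card (?T - gen_tuples R M d)) \<le> (\<Sum>K\<in>max_submodules R M. real (card K) ^ d)"
    by (simp add: card_PiE flip: of_nat_power of_nat_sum)
  also have "\<dots> \<le> (\<Sum>K\<in>max_submodules R M. (n / 2) ^ d)"
  proof (rule sum_mono, rule power_mono)
    fix K assume K: "K \<in> max_submodules R M"
    have "2 * card K \<le> card (carrier M)"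
      using Kd[OF K] submoduleD(6)[of K] by (intro M.card_proper_subgroup fin) (auto simp: abelian_subgroup_def)
    then show "real (card K) \<le> n / 2" by (simp add: n_def)
  qed simp
  also have "\<dots> = real (card (max_submodules R M)) * (n / 2) ^ d" by simp
  also have "\<dots> \<le> 2 * n * ln n * (n / 2) ^ d"
  proof (rule mult_right_mono)
    have pos: "card (carrier M) > 0" using fin by (auto simp: card_gt_0_iff)
    show "real (card (max_submodules R M)) \<le> 2 * n * ln n"
    proof (cases "card (carrier M) = 1")
      case True
      then obtain z where z: "carrier M = {z}" by (auto simp: card_1_singleton_iff)
      have "K = carrier M" if "submodule K R M" for K
        using submoduleD(1,2)[OF that] z by auto
      then have "max_submodules R M = {}" by (auto simp: max_submodules_def)
      then show ?thesis using True by (simp add: n_def)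
    next
      case False
      then have n2: "n \<ge> 2" using pos by (simp add: n_def)
      have "1 / 2 \<le> ln (2::real)" using ln_le_minus_one[of "1 / 2 :: real"] by (simp add: ln_div)
      also have "\<dots> \<le> ln n" using n2 by simp
      finally have "n * 1 \<le> n * (2 * ln n)" using n2 by (intro mult_left_mono) auto
      then have "n \<le> 2 * n * ln n" by simp
      then show ?thesis using card_max_submodules_le[OF fin] by (simp add: n_def)
    qed
  qed (simp add: n_def)
  finally show ?thesis using nongen by simp
qed

end

section \<open>Groupoid cardinality and quotients of free modules\<close>

lemma restrict_scalars_simps [simp]:
  "carrier (restrict_scalars \<phi> M) = carrier M"
  "x \<oplus>\<^bsub>restrict_scalars \<phi> M\<^esub> y = x \<oplus>\<^bsub>M\<^esub> y"
  "s \<odot>\<^bsub>restrict_scalars \<phi> M\<^esub> x = \<phi> s \<odot>\<^bsub>M\<^esub> x"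
  by (simp_all add: restrict_scalars_def)

lemma ops_closed_restrict_scalars:
  "left_module R M \<Longrightarrow> \<phi> \<in> carrier S \<rightarrow> carrier R \<Longrightarrow> ops_closed S (restrict_scalars \<phi> M)"
  using left_module.ops_closed[of R M] by (auto simp: ops_closed_def)

lemma mod_isos_restrict_scalars:
  "h \<in> mod_isos R M M' \<Longrightarrow> \<phi> \<in> carrier S \<rightarrow> carrier R \<Longrightarrow>
    h \<in> mod_isos S (restrict_scalars \<phi> M) (restrict_scalars \<phi> M')"
  by (auto simp: mod_isos_iff mod_hom_def Pi_iff)

lemma mod_isomorphic_restrict_scalars:
  "mod_isomorphic R M M' \<Longrightarrow> \<phi> \<in> carrier S \<rightarrow> carrier R \<Longrightarrow>
    mod_isomorphic S (restrict_scalars \<phi> M) (restrict_scalars \<phi> M')"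
  using mod_isos_restrict_scalars unfolding mod_isomorphic_def by blast

lemma mod_isomorphic_bij:
  "mod_isomorphic R M N \<Longrightarrow> \<exists>h. bij_betw h (carrier M) (carrier N)"
  by (auto simp: mod_isomorphic_def mod_isos_iff)

text \<open>Every module that is in bijection with \<open>N\<close> has an isomorphic copy in the type of the elements of \<open>N\<close>,
  from which the groupoid takes its objects.\<close>

lemma exists_transported_module:
  fixes N :: "('s, 'n, 'k) module_scheme"
  assumes Q: "left_module R Q" and h: "bij_betw h (carrier Q) (carrier N)"
  shows "\<exists>M :: ('a, 'n) module. left_module R M \<and> mod_isomorphic R Q M"
proof -
  interpret Q: left_module R Q by fact
  let ?i = "inv_into (carrier Q) h"
  define M :: "('a, 'n) module" where "M = \<lparr>carrier = carrier N, mult = undefined, one = undefined,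
    zero = h \<zero>\<^bsub>Q\<^esub>, add = (\<lambda>u v. h (?i u \<oplus>\<^bsub>Q\<^esub> ?i v)), smult = (\<lambda>a u. h (a \<odot>\<^bsub>Q\<^esub> ?i u))\<rparr>"
  have i: "?i (h x) = x" if "x \<in> carrier Q" for x
    using h that by (auto simp: bij_betw_def)
  have M: "left_module R M"
    by (rule left_module_surj_image[OF Q, of h]) (use h in \<open>auto simp: M_def i bij_betw_def\<close>)
  have "restrict h (carrier Q) \<in> mod_isos R Q M"
    unfolding mod_isos_iff mod_hom_def using h
    by (auto simp: M_def i bij_betw_def inj_on_def)
  with M show ?thesis by (auto simp: mod_isomorphic_def)
qed

context
  fixes S :: "('s, 'e) ring_scheme" and R :: "('a, 'g) ring_scheme" and \<phi> :: "'s \<Rightarrow> 'a"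
    and N :: "('s, 'n, 'k) module_scheme"
  assumes R: "ring R" and \<phi>: "\<phi> \<in> carrier S \<rightarrow> carrier R"
    and fin: "finite (carrier N)"
begin

lemma coh_objectsD:
  assumes "M \<in> coh_objects S R \<phi> N"
  shows "left_module R M" and "mod_isomorphic S (restrict_scalars \<phi> M) N"
    and "ops_closed R M" and "ops_closed S (restrict_scalars \<phi> M)"
    and "finite (carrier M)" and "card (carrier M) = card (carrier N)"
proof -
  show M: "left_module R M" "mod_isomorphic S (restrict_scalars \<phi> M) N"
    using assms by (auto simp: coh_objects_def)
  then show "ops_closed R M" "ops_closed S (restrict_scalars \<phi> M)"
    using \<phi> by (auto intro: left_module.ops_closed ops_closed_restrict_scalars)
  obtain h where "bij_betw h (carrier M) (carrier N)"
    using mod_isomorphic_bij[OF M(2)] by auto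
  then show "finite (carrier M)" "card (carrier M) = card (carrier N)"
    using fin by (auto simp: bij_betw_finite bij_betw_same_card)
qed

lemma equiv_coh_iso_rel: "equiv (coh_objects S R \<phi> N) (coh_iso_rel S R \<phi> N)"
proof (rule equivI)
  show "coh_iso_rel S R \<phi> N \<subseteq> coh_objects S R \<phi> N \<times> coh_objects S R \<phi> N"
    by (auto simp: coh_iso_rel_def)
  show "refl_on (coh_objects S R \<phi> N) (coh_iso_rel S R \<phi> N)"
    by (auto simp: refl_on_def coh_iso_rel_def intro: mod_isomorphic_refl coh_objectsD)
  show "sym (coh_iso_rel S R \<phi> N)"
    by (auto simp: sym_def coh_iso_rel_def intro: mod_isomorphic_sym coh_objectsD)
  show "trans (coh_iso_rel S R \<phi> N)"
    unfolding trans_def coh_iso_rel_def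
    using mod_isomorphic_trans coh_objectsD(3) by blast
qed

text \<open>The representative of an isomorphism class at which \<^const>\<open>coh_card\<close> counts automorphisms.\<close>

abbreviation (input) "coh_rep X \<equiv> SOME M. M \<in> X"

lemma coh_rep:
  assumes "X \<in> coh_objects S R \<phi> N // coh_iso_rel S R \<phi> N"
  shows "coh_rep X \<in> X" and "coh_rep X \<in> coh_objects S R \<phi> N"
proof -
  have "X \<noteq> {}" "X \<subseteq> coh_objects S R \<phi> N"
    using assms equiv_coh_iso_rel in_quotient_imp_non_empty in_quotient_imp_subset by metis+
  then show "coh_rep X \<in> X" "coh_rep X \<in> coh_objects S R \<phi> N"
    using some_in_eq by blast+
qed

lemma coh_rep_isomorphic_imp_eq:
  assumes X: "X \<in> coh_objects S R \<phi> N // coh_iso_rel S R \<phi> N"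
    and Y: "Y \<in> coh_objects S R \<phi> N // coh_iso_rel S R \<phi> N"
    and iso: "mod_isomorphic R (coh_rep X) (coh_rep Y)"
  shows "X = Y"
proof -
  have "(coh_rep X, coh_rep Y) \<in> coh_iso_rel S R \<phi> N"
    using coh_rep(2)[OF X] coh_rep(2)[OF Y] iso by (simp add: coh_iso_rel_def)
  then show ?thesis
    using quotient_eqI[OF equiv_coh_iso_rel X Y coh_rep(1)[OF X] coh_rep(1)[OF Y]] by blast
qed

lemma coh_object_isomorphic_rep:
  assumes M: "M \<in> coh_objects S R \<phi> N"
  shows "\<exists>X\<in>coh_objects S R \<phi> N // coh_iso_rel S R \<phi> N. mod_isomorphic R M (coh_rep X)"
proof
  let ?X = "coh_iso_rel S R \<phi> N `` {M}"
  show X: "?X \<in> coh_objects S R \<phi> N // coh_iso_rel S R \<phi> N" using M by (rule quotientI)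
  show "mod_isomorphic R M (coh_rep ?X)"
    using coh_rep(1)[OF X] unfolding coh_iso_rel_def by auto
qed

lemma Quot_set_decomposition:
  fixes d :: nat
  defines "F \<equiv> free_left_module R d"
  defines "Q \<equiv> \<lambda>X. {E. submodule E R F \<and> mod_isomorphic R (quotient_module F E) (coh_rep X)}"
  shows "Quot_set S R \<phi> d N = (\<Union>X\<in>coh_objects S R \<phi> N // coh_iso_rel S R \<phi> N. Q X)"
    and "\<lbrakk>X \<in> coh_objects S R \<phi> N // coh_iso_rel S R \<phi> N;
      Y \<in> coh_objects S R \<phi> N // coh_iso_rel S R \<phi> N; X \<noteq> Y\<rbrakk> \<Longrightarrow> Q X \<inter> Q Y = {}"
proof -
  let ?C = "coh_objects S R \<phi> N // coh_iso_rel S R \<phi> N"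
  interpret F: left_module R F unfolding F_def by (rule ring.left_module_free[OF R])
  have LQ: "left_module R (quotient_module F E)" if "submodule E R F" for E
    using that by (rule F.left_module_quotient)
  show "Quot_set S R \<phi> d N = (\<Union>X\<in>?C. Q X)"
  proof (intro equalityI subsetI)
    fix E assume "E \<in> Quot_set S R \<phi> d N"
    then have E: "submodule E R F"
      and iso: "mod_isomorphic S (restrict_scalars \<phi> (quotient_module F E)) N"
      by (auto simp: Quot_set_def F_def)
    obtain h where h: "bij_betw h (carrier (quotient_module F E)) (carrier N)"
      using mod_isomorphic_bij[OF iso] by auto
    from exists_transported_module[OF LQ[OF E] h]
    obtain M :: "('a, 'n) module" where M: "left_module R M" "mod_isomorphic R (quotient_module F E) M"
      by (elim exE conjE)
    have "mod_isomorphic S (restrict_scalars \<phi> M) (restrict_scalars \<phi> (quotient_module F E))"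
      using mod_isomorphic_sym[OF M(2) left_module.ops_closed[OF LQ[OF E]]] \<phi>
      by (rule mod_isomorphic_restrict_scalars)
    then have "mod_isomorphic S (restrict_scalars \<phi> M) N"
      using iso ops_closed_restrict_scalars[OF M(1) \<phi>] by (rule mod_isomorphic_trans)
    then have "M \<in> coh_objects S R \<phi> N" using M by (simp add: coh_objects_def)
    then obtain X where X: "X \<in> ?C" "mod_isomorphic R M (coh_rep X)"
      using coh_object_isomorphic_rep by blast
    have "mod_isomorphic R (quotient_module F E) (coh_rep X)"
      using M(2) X(2) left_module.ops_closed[OF LQ[OF E]] by (rule mod_isomorphic_trans)
    then show "E \<in> (\<Union>X\<in>?C. Q X)" using X(1) E by (auto simp: Q_def)
  next
    fix E assume "E \<in> (\<Union>X\<in>?C. Q X)"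
    then obtain X where X: "X \<in> ?C" and E: "submodule E R F"
      and iso: "mod_isomorphic R (quotient_module F E) (coh_rep X)" by (auto simp: Q_def)
    have "mod_isomorphic S (restrict_scalars \<phi> (quotient_module F E)) (restrict_scalars \<phi> (coh_rep X))"
      using iso \<phi> by (rule mod_isomorphic_restrict_scalars)
    then have "mod_isomorphic S (restrict_scalars \<phi> (quotient_module F E)) N"
      using coh_objectsD(2)[OF coh_rep(2)[OF X]] ops_closed_restrict_scalars[OF LQ[OF E] \<phi>]
      by (rule mod_isomorphic_trans)
    then show "E \<in> Quot_set S R \<phi> d N" using E by (simp add: Quot_set_def F_def)
  qed
  assume X: "X \<in> ?C" and Y: "Y \<in> ?C" and "X \<noteq> Y"
  show "Q X \<inter> Q Y = {}"
  proof (rule ccontr)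
    assume "Q X \<inter> Q Y \<noteq> {}"
    then obtain E where E: "submodule E R F" "mod_isomorphic R (quotient_module F E) (coh_rep X)"
      "mod_isomorphic R (quotient_module F E) (coh_rep Y)" by (auto simp: Q_def)
    have "mod_isomorphic R (coh_rep X) (coh_rep Y)"
      using mod_isomorphic_sym[OF E(2) left_module.ops_closed[OF LQ[OF E(1)]]] E(3)
        coh_objectsD(3)[OF coh_rep(2)[OF X]] by (rule mod_isomorphic_trans)
    with X Y \<open>X \<noteq> Y\<close> show False using coh_rep_isomorphic_imp_eq by blast
  qed
qed

lemma coh_card_Quot_bounds:
  fixes d :: nat
  assumes finC: "finite (coh_objects S R \<phi> N // coh_iso_rel S R \<phi> N)"
  defines "n \<equiv> real (card (carrier N))"
  shows "0 \<le> coh_card S R \<phi> N - real (card (Quot_set S R \<phi> d N)) / n ^ d"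
    and "coh_card S R \<phi> N - real (card (Quot_set S R \<phi> d N)) / n ^ d
      \<le> 2 * n * ln n * coh_card S R \<phi> N / 2 ^ d"
proof -
  let ?C = "coh_objects S R \<phi> N // coh_iso_rel S R \<phi> N"
  let ?F = "free_left_module R d"
  define A where "A X = real (card (mod_auts R (coh_rep X)))" for X :: "('a, 'n) module set"
  define G where "G X = real (card (gen_tuples R (coh_rep X) d))" for X :: "('a, 'n) module set"
  define Q where "Q X = {E. submodule E R ?F \<and> mod_isomorphic R (quotient_module ?F E) (coh_rep X)}"
    for X :: "('a, 'n) module set"
  have facts: "0 < A X" "finite (Q X)" "G X = real (card (Q X)) * A X" "G X \<le> n ^ d"
      "n ^ d - G X \<le> 2 * n * ln n * (n / 2) ^ d" "0 < n" if X: "X \<in> ?C" for X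
  proof -
    note M = coh_objectsD[OF coh_rep(2)[OF X]]
    interpret M: left_module R "coh_rep X" by (rule M(1))
    show "0 < A X" unfolding A_def using card_mod_auts_pos[OF M(3,5)] by simp
    show "finite (Q X)" unfolding Q_def using M.card_gen_tuples(1)[OF M(5)] .
    show "G X = real (card (Q X)) * A X"
      unfolding G_def A_def Q_def M.card_gen_tuples(2)[OF M(5)] by simp
    have "card (gen_tuples R (coh_rep X) d) \<le> card ({..<d} \<rightarrow>\<^sub>E carrier (coh_rep X))"
      using M(5) by (intro card_mono finite_PiE M.gen_tuples_subset) auto
    then show "G X \<le> n ^ d"
      by (simp add: G_def n_def card_PiE M(6) flip: of_nat_power)
    show "n ^ d - G X \<le> 2 * n * ln n * (n / 2) ^ d"
      using M.card_nongen_tuples_le[OF M(5), of d] by (simp add: G_def n_def M(6))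
    show "0 < n" using M(5,6) by (auto simp: n_def card_gt_0_iff simp flip: M(6))
  qed
  have coh: "coh_card S R \<phi> N = (\<Sum>X\<in>?C. 1 / A X)"
    unfolding coh_card_def A_def using finC by simp
  have "card (Quot_set S R \<phi> d N) = (\<Sum>X\<in>?C. card (Q X))"
    unfolding Quot_set_decomposition(1) Q_def[symmetric]
    using finC facts(2) Quot_set_decomposition(2) by (intro card_UN_disjoint) (auto simp: Q_def)
  then have "real (card (Quot_set S R \<phi> d N)) / n ^ d = (\<Sum>X\<in>?C. real (card (Q X)) / n ^ d)"
    by (simp add: sum_divide_distrib)
  also have "\<dots> = (\<Sum>X\<in>?C. G X / n ^ d / A X)"
  proof (intro sum.cong refl)
    fix X assume X: "X \<in> ?C"
    show "real (card (Q X)) / n ^ d = G X / n ^ d / A X"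
      using facts(1,3)[OF X] by simp
  qed
  finally have diff: "coh_card S R \<phi> N - real (card (Quot_set S R \<phi> d N)) / n ^ d =
      (\<Sum>X\<in>?C. (1 - G X / n ^ d) / A X)"
    by (simp add: coh sum_subtractf diff_divide_distrib)
  show "0 \<le> coh_card S R \<phi> N - real (card (Quot_set S R \<phi> d N)) / n ^ d"
    unfolding diff
  proof (rule sum_nonneg)
    fix X assume X: "X \<in> ?C"
    show "0 \<le> (1 - G X / n ^ d) / A X" using facts(1,4,6)[OF X] by simp
  qed
  have "(\<Sum>X\<in>?C. (1 - G X / n ^ d) / A X) \<le> (\<Sum>X\<in>?C. 2 * n * ln n / 2 ^ d * (1 / A X))"
  proof (rule sum_mono)
    fix X assume X: "X \<in> ?C"
    have "1 - G X / n ^ d = (n ^ d - G X) / n ^ d" using facts(6)[OF X] by (simp add: field_simps)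
    also have "\<dots> \<le> 2 * n * ln n * (n / 2) ^ d / n ^ d"
      using facts(5,6)[OF X] by (intro divide_right_mono) auto
    also have "\<dots> = 2 * n * ln n / 2 ^ d" using facts(6)[OF X] by (simp add: power_divide)
    finally have "(1 - G X / n ^ d) / A X \<le> 2 * n * ln n / 2 ^ d / A X"
      using facts(1)[OF X] by (intro divide_right_mono) auto
    then show "(1 - G X / n ^ d) / A X \<le> 2 * n * ln n / 2 ^ d * (1 / A X)" by simp
  qed
  also have "\<dots> = 2 * n * ln n * coh_card S R \<phi> N / 2 ^ d"
    unfolding coh sum_distrib_left[symmetric] by simp
  finally show "coh_card S R \<phi> N - real (card (Quot_set S R \<phi> d N)) / n ^ d
      \<le> 2 * n * ln n * coh_card S R \<phi> N / 2 ^ d"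
    unfolding diff .
qed

end

text \<open>If two modules yield the same self-maps of \<open>N\<close>, then the composite bijection between them is
  linear over the scalars and commutes with the variables, so it commutes with every element of the
  algebra, by \<open>fp_algebra_induct\<close>.\<close>

lemma (in cring) finite_coh_classes:
  fixes m r :: nat and f :: "nat \<Rightarrow> nat list \<Rightarrow> 'a" and N :: "('a, 'n, 'k) module_scheme"
  assumes f: "\<And>j. j < r \<Longrightarrow> f j \<in> carrier (free_algebra R m)"
    and fin: "finite (carrier N)"
  defines "A \<equiv> fp_algebra R m r f" and "\<phi> \<equiv> fp_algebra_map R m r f"
  shows "finite (coh_objects R A \<phi> N // coh_iso_rel R A \<phi> N)"
proof -
  let ?C = "coh_objects R A \<phi> N // coh_iso_rel R A \<phi> N"
  let ?T = "fp_algebra_var R m r f"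
  have ringA: "ring A" unfolding A_def using f by (rule ring_fp_algebra)
  have \<phi>: "\<phi> \<in> carrier R \<rightarrow> carrier A"
    unfolding A_def \<phi>_def using fp_algebra_map_closed[of r f m] f by blast
  have T: "?T i \<in> carrier A" if "i < m" for i
    unfolding A_def using fp_algebra_var_closed[of r f m i] f that by blast
  \<comment> \<open>\<open>h M\<close> is a chosen isomorphism from \<open>M\<close> to \<open>N\<close> over the scalars, and
    \<open>act M\<close> is the action of the variables on \<open>M\<close>, transported to \<open>N\<close>\<close>
  define h where "h M = (SOME h. h \<in> mod_isos R (restrict_scalars \<phi> M) N)"
    for M :: "((nat list \<Rightarrow> 'a) set, 'n) module"
  define act where "act M = (\<lambda>i\<in>{..<m}. \<lambda>y\<in>carrier N.
    h M (?T i \<odot>\<^bsub>M\<^esub> inv_into (carrier M) (h M) y))"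
    for M :: "((nat list \<Rightarrow> 'a) set, 'n) module"
  note D = coh_objectsD[OF ringA \<phi> fin]
  note rep = coh_rep[OF ringA \<phi> fin]
  have h: "h M \<in> mod_isos R (restrict_scalars \<phi> M) N" if "M \<in> coh_objects R A \<phi> N" for M
    unfolding h_def using D(2)[OF that] some_in_eq by (auto simp: mod_isomorphic_def)
  have inv: "inv_into (carrier M) (h M) y \<in> carrier M" "h M (inv_into (carrier M) (h M) y) = y"
    if "M \<in> coh_objects R A \<phi> N" "y \<in> carrier N" for M y
    using h[OF that(1)] that(2)
    by (auto simp: mod_isos_iff bij_betw_def intro: inv_into_into f_inv_into_f)
  have hM: "h M x \<in> carrier N" "inv_into (carrier M) (h M) (h M x) = x"
    if "M \<in> coh_objects R A \<phi> N" "x \<in> carrier M" for M x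
    using h[OF that(1)] that(2) by (auto simp: mod_isos_iff bij_betw_def)
  have smult: "a \<odot>\<^bsub>M\<^esub> x \<in> carrier M" if "M \<in> coh_objects R A \<phi> N" "a \<in> carrier A" "x \<in> carrier M" for M a x
    using D(3)[OF that(1)] that by (auto simp: ops_closed_def)
  have iso: "mod_isomorphic A M M'"
    if M: "M \<in> coh_objects R A \<phi> N" and M': "M' \<in> coh_objects R A \<phi> N" and eq: "act M = act M'" for M M'
  proof -
    interpret M: left_module A M using D(1)[OF M] .
    interpret M': left_module A M' using D(1)[OF M'] .
    define g where "g = (\<lambda>x\<in>carrier M. inv_into (carrier M') (h M') (h M x))"
    have "(\<lambda>y\<in>carrier N. inv_into (carrier M') (h M') y) \<in> mod_isos R N (restrict_scalars \<phi> M')"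
      using mod_iso_inverse[OF h[OF M'] D(4)[OF M']] by simp
    from mod_iso_comp[OF h[OF M] this D(4)[OF M]]
    have "(\<lambda>x\<in>carrier M. (\<lambda>y\<in>carrier N. inv_into (carrier M') (h M') y) (h M x))
        \<in> mod_isos R (restrict_scalars \<phi> M) (restrict_scalars \<phi> M')" by simp
    also have "(\<lambda>x\<in>carrier M. (\<lambda>y\<in>carrier N. inv_into (carrier M') (h M') y) (h M x)) = g"
      unfolding g_def using hM(1)[OF M] by (intro restrict_ext) simp
    finally have g: "g \<in> mod_isos R (restrict_scalars \<phi> M) (restrict_scalars \<phi> M')" .
    then have hom: "mod_hom R (restrict_scalars \<phi> M) (restrict_scalars \<phi> M') g"
      by (simp add: mod_isos_iff)
    note gD = mod_homD[OF hom, simplified]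
    have "\<forall>x\<in>carrier M. g (a \<odot>\<^bsub>M\<^esub> x) = a \<odot>\<^bsub>M'\<^esub> g x" if "a \<in> carrier A" for a
      using that unfolding A_def
    proof (induction a rule: fp_algebra_induct)
      case (rel j)
      then show ?case by (rule f)
    next
      case (const s)
      then show ?case using gD(3) by (simp add: \<phi>_def)
    next
      case (var i)
      show ?case
      proof
        fix x assume x: "x \<in> carrier M"
        have gx: "g x \<in> carrier M'" "g x = inv_into (carrier M') (h M') (h M x)"
          using gD(1)[OF x] x by (auto simp: g_def)
        have "h M (?T i \<odot>\<^bsub>M\<^esub> x) = act M i (h M x)"
          using var hM[OF M x] by (simp add: act_def)
        also have "\<dots> = h M' (?T i \<odot>\<^bsub>M'\<^esub> g x)"
          using var hM[OF M x] by (simp add: eq) (simp add: act_def gx(2))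
        finally have "g (?T i \<odot>\<^bsub>M\<^esub> x) = inv_into (carrier M') (h M') (h M' (?T i \<odot>\<^bsub>M'\<^esub> g x))"
          using smult[OF M T[OF var] x] by (simp add: g_def)
        also have "\<dots> = ?T i \<odot>\<^bsub>M'\<^esub> g x"
          by (rule hM(2)[OF M' smult[OF M' T[OF var] gx(1)]])
        finally show "g (?T i \<odot>\<^bsub>M\<^esub> x) = ?T i \<odot>\<^bsub>M'\<^esub> g x" .
      qed
    next
      case (add a b)
      then show ?case
        unfolding A_def[symmetric] using gD(1,2) by (auto simp: M.smult_l_distr M'.smult_l_distr)
    next
      case (mult a b)
      then show ?case
        unfolding A_def[symmetric] using gD(1) by (auto simp: M.smult_assoc M'.smult_assoc)
    qed
    then have "g \<in> mod_isos A M M'"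
      using g by (auto simp: mod_isos_iff mod_hom_def)
    then show ?thesis by (auto simp: mod_isomorphic_def)
  qed
  have "inj_on (\<lambda>X. act (SOME M. M \<in> X)) ?C"
    using iso rep(2) coh_rep_isomorphic_imp_eq[OF ringA \<phi> fin] by (intro inj_onI) blast
  moreover have "(\<lambda>X. act (SOME M. M \<in> X)) ` ?C \<subseteq> {..<m} \<rightarrow>\<^sub>E (carrier N \<rightarrow>\<^sub>E carrier N)"
  proof
    fix t assume "t \<in> (\<lambda>X. act (SOME M. M \<in> X)) ` ?C"
    then obtain M where M: "M \<in> coh_objects R A \<phi> N" "t = act M" using rep(2) by blast
    then show "t \<in> {..<m} \<rightarrow>\<^sub>E (carrier N \<rightarrow>\<^sub>E carrier N)"
      using hM(1)[OF M(1) smult[OF M(1) T inv(1)[OF M(1)]]] by (auto simp: act_def)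
  qed
  moreover have "finite ({..<m} \<rightarrow>\<^sub>E (carrier N \<rightarrow>\<^sub>E carrier N))"
    using fin by (intro finite_PiE) auto
  ultimately show ?thesis by (rule inj_on_finite)
qed

theorem proposition3p13:
  fixes S :: "('s, 'e) ring_scheme"
    and N :: "('s, 'n, 'k) module_scheme"
    and m r :: nat
    and f :: "nat \<Rightarrow> nat list \<Rightarrow> 's"
    and R :: "(nat list \<Rightarrow> 's) set ring"
    and \<phi> :: "'s \<Rightarrow> (nat list \<Rightarrow> 's) set"
  assumes "cring S"
    and "\<And>j. j < r \<Longrightarrow> f j \<in> carrier (free_algebra S m)"
    and "R = fp_algebra S m r f"
    and "\<phi> = fp_algebra_map S m r f"
    and "Module.module S N"
    and "finite (carrier N)"
  shows "(\<forall>d::nat.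
      0 \<le> coh_card S R \<phi> N - real (card (Quot_set S R \<phi> d N)) / real (card (carrier N)) ^ d \<and>
      coh_card S R \<phi> N - real (card (Quot_set S R \<phi> d N)) / real (card (carrier N)) ^ d
        \<le> 2 * real (card (carrier N)) * ln (real (card (carrier N))) * coh_card S R \<phi> N
            * (2::real) powi (- int d)) \<and>
    (\<lambda>d. real (card (Quot_set S R \<phi> d N)) / real (card (carrier N)) ^ d)
      \<longlonglongrightarrow> coh_card S R \<phi> N"
proof -
  interpret S: cring S by fact
  let ?n = "real (card (carrier N))"
  let ?q = "\<lambda>d. real (card (Quot_set S R \<phi> d N)) / ?n ^ d"
  let ?K = "2 * ?n * ln ?n * coh_card S R \<phi> N"
  have R: "ring R" using S.ring_fp_algebra[of r f m] assms(2,3) by simp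
  have \<phi>: "\<phi> \<in> carrier S \<rightarrow> carrier R"
    using S.fp_algebra_map_closed[of r f m] assms(2-4) by blast
  have fin: "finite (coh_objects S R \<phi> N // coh_iso_rel S R \<phi> N)"
    using S.finite_coh_classes[of r f m N] assms(2-4,6) by simp
  note bounds = coh_card_Quot_bounds[OF R \<phi> assms(6) fin]
  have lower: "0 \<le> coh_card S R \<phi> N - ?q d" and upper: "coh_card S R \<phi> N - ?q d \<le> ?K * 2 powi (- int d)" for d
    using bounds[of d] by (simp_all add: power_int_minus field_simps)
  have "(\<lambda>d. coh_card S R \<phi> N - ?q d) \<longlonglongrightarrow> 0"
  proof (rule tendsto_sandwich[OF _ _ tendsto_const])
    show "(\<lambda>d. ?K * (1 / 2) ^ d) \<longlonglongrightarrow> 0"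
      by (intro tendsto_mult_right_zero LIMSEQ_realpow_zero) auto
    show "\<forall>\<^sub>F d in sequentially. coh_card S R \<phi> N - ?q d \<le> ?K * (1 / 2) ^ d"
      using upper by (intro always_eventually allI) (simp add: power_int_minus field_simps)
  qed (use lower in auto)
  then have "(\<lambda>d. coh_card S R \<phi> N - (coh_card S R \<phi> N - ?q d)) \<longlonglongrightarrow> coh_card S R \<phi> N - 0"
    by (intro tendsto_diff tendsto_const)
  then show ?thesis using lower upper by simp
qed

end
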